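(* If $G$ is a bipartite graph such that $\mathrm{Ind}(G)$ is Cohen-Macaulay, then the $h$-vector of $\mathrm{Ind}(G)$ (with trailing zeros removed) is the face vector of some flag complex.
   Context: $\mathrm{Ind}(G)$ is the simplicial complex of independent sets of $G$; Cohen-Macaulay means its Stanley–Reisner ring over a field is Cohen-Macaulay. A flag complex is the independence complex of some graph. For a $(d-1)$-dimensional complex with face vector $(f_{-1},\ldots,f_{d-1})$ ($f_i$ = number of faces with $i+1$ elements), the $h$-vector is $(h_0,\ldots,h_d)$, $h_j=\sum_{i=0}^{j}(-1)^{j-i}\binom{d-i}{j-i}f_{i-1}$. *)

theory Defs
  imports Main "HOL-Library.Poly_Mapping" "HOL-Library.Extended_Nat"
begin

definition is_ideal :: "'a::comm_ring_1 set \<Rightarrow> bool" where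
  "is_ideal J \<longleftrightarrow> 0 \<in> J \<and> (\<forall>x\<in>J. \<forall>y\<in>J. x - y \<in> J) \<and> (\<forall>r. \<forall>x\<in>J. r * x \<in> J)"

definition ideal_gen :: "'a::comm_ring_1 set \<Rightarrow> 'a set" where
  "ideal_gen A = {x. \<exists>F c. finite F \<and> F \<subseteq> A \<and> x = (\<Sum>a\<in>F. c a * a)}"

definition is_prime_ideal :: "'a::comm_ring_1 set \<Rightarrow> bool" where
  "is_prime_ideal P \<longleftrightarrow> is_ideal P \<and> P \<noteq> UNIV \<and> (\<forall>a b. a * b \<in> P \<longrightarrow> a \<in> P \<or> b \<in> P)"

definition is_maximal_ideal :: "'a::comm_ring_1 set \<Rightarrow> bool" where
  "is_maximal_ideal M \<longleftrightarrow> is_ideal M \<and> M \<noteq> UNIV \<and>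
     (\<forall>J. is_ideal J \<and> M \<subseteq> J \<longrightarrow> J = M \<or> J = UNIV)"

text \<open>All notions below concern the quotient ring R = S/I, expressed through
  ideals of S containing I (correspondence theorem).\<close>

definition quot_height :: "'a::comm_ring_1 set \<Rightarrow> 'a set \<Rightarrow> enat" where
  "quot_height I M = (SUP n \<in> {n. \<exists>P :: nat \<Rightarrow> 'a set.
       (\<forall>i\<le>n. is_prime_ideal (P i) \<and> I \<subseteq> P i) \<and>
       (\<forall>i<n. P i \<subset> P (Suc i)) \<and> P n \<subseteq> M}. enat n)"

definition quot_regular_seq :: "'a::comm_ring_1 set \<Rightarrow> 'a list \<Rightarrow> bool" where
  "quot_regular_seq I xs \<longleftrightarrow>
     (\<forall>i<length xs. \<forall>y. xs ! i * y \<in> ideal_gen (I \<union> set (take i xs))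
                         \<longrightarrow> y \<in> ideal_gen (I \<union> set (take i xs))) \<and>
     ideal_gen (I \<union> set xs) \<noteq> UNIV"

definition quot_grade :: "'a::comm_ring_1 set \<Rightarrow> 'a set \<Rightarrow> enat" where
  "quot_grade I M = (SUP n \<in> {length xs | xs. set xs \<subseteq> M \<and> quot_regular_seq I xs}. enat n)"

text \<open>The (Noetherian) ring S/I is Cohen-Macaulay: each localization at a maximal
  ideal m is Cohen-Macaulay, i.e. depth (S/I)_m = grade m = height m = dim (S/I)_m.\<close>
definition quot_cohen_macaulay :: "'a::comm_ring_1 set \<Rightarrow> bool" where
  "quot_cohen_macaulay I \<longleftrightarrow>
     (\<forall>M. is_maximal_ideal M \<and> I \<subseteq> M \<longrightarrow> quot_grade I M = quot_height I M)"

type_synonym ('v, 'k) mpoly = "('v \<Rightarrow>\<^sub>0 nat) \<Rightarrow>\<^sub>0 'k"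

definition sqfree_monomial :: "'v set \<Rightarrow> ('v, 'k::field) mpoly" where
  "sqfree_monomial F = Poly_Mapping.single (\<Sum>v\<in>F. Poly_Mapping.single v (1::nat)) 1"

text \<open>Stanley-Reisner ideal of a simplicial complex Delta on the vertex set UNIV :: 'v set
  (finite type): generated by the monomials x_F of non-faces F.\<close>
definition stanley_reisner_ideal :: "'v::finite set set \<Rightarrow> ('v, 'k::field) mpoly set" where
  "stanley_reisner_ideal Delta = ideal_gen {sqfree_monomial F | F. F \<notin> Delta}"

definition cohen_macaulay_over :: "'k::field itself \<Rightarrow> 'v::finite set set \<Rightarrow> bool" where
  "cohen_macaulay_over TYPE('k) Delta \<longleftrightarrow>
     quot_cohen_macaulay (stanley_reisner_ideal Delta :: ('v, 'k) mpoly set)"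

definition simple_graph_on :: "'v set \<Rightarrow> ('v \<Rightarrow> 'v \<Rightarrow> bool) \<Rightarrow> bool" where
  "simple_graph_on V E \<longleftrightarrow> finite V \<and> (\<forall>u v. E u v \<longrightarrow> u \<in> V \<and> v \<in> V \<and> u \<noteq> v \<and> E v u)"

definition bipartite_on :: "'v set \<Rightarrow> ('v \<Rightarrow> 'v \<Rightarrow> bool) \<Rightarrow> bool" where
  "bipartite_on V E \<longleftrightarrow> (\<exists>A \<subseteq> V. \<forall>u v. E u v \<longrightarrow> (u \<in> A \<longleftrightarrow> v \<notin> A))"

definition independent :: "('v \<Rightarrow> 'v \<Rightarrow> bool) \<Rightarrow> 'v set \<Rightarrow> bool" where
  "independent E F \<longleftrightarrow> (\<forall>u\<in>F. \<forall>v\<in>F. \<not> E u v)"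

definition Ind :: "'v set \<Rightarrow> ('v \<Rightarrow> 'v \<Rightarrow> bool) \<Rightarrow> 'v set set" where
  "Ind V E = {F. F \<subseteq> V \<and> independent E F}"

text \<open>fcount Delta i = f_{i-1} = number of faces with i elements.\<close>
definition fcount :: "'v set set \<Rightarrow> nat \<Rightarrow> nat" where
  "fcount Delta i = card {F \<in> Delta. card F = i}"

text \<open>d = dim + 1 = maximal size of a face (for a finite complex).\<close>
definition cx_d :: "'v set set \<Rightarrow> nat" where
  "cx_d Delta = Max (card ` Delta)"

definition hvec :: "'v set set \<Rightarrow> nat \<Rightarrow> int" where
  "hvec Delta j = (\<Sum>i=0..j. (-1) ^ (j - i) * int ((cx_d Delta - i) choose (j - i)) * int (fcount Delta i))"

definition hvec_last :: "'v set set \<Rightarrow> nat" where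
  "hvec_last Delta = (GREATEST j. j \<le> cx_d Delta \<and> hvec Delta j \<noteq> 0)"

definition face_vector_is :: "'w set set \<Rightarrow> int list \<Rightarrow> bool" where
  "face_vector_is Delta hs \<longleftrightarrow> length hs = cx_d Delta + 1 \<and>
     (\<forall>i \<le> cx_d Delta. int (fcount Delta i) = hs ! i)"

end

theory Submission
  imports Defs
begin

text \<open>Localising the Stanley-Reisner ring at the 0/1-point supported on a face \<open>F\<close> amounts to
  passing to the link of \<open>F\<close>. A disconnected link has depth 1 there, so in a Cohen-Macaulay
  complex a disconnected link has dimension 0. For the independence complex of a bipartite graph
  \<open>G\<close> this says: if deleting an independent set with its neighbours leaves a complete bipartite
  graph with two nonempty sides, then that graph is a single edge. A vertex \<open>y\<close> with inclusion-minimal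
  nonempty neighbourhood is therefore a leaf, and by induction the non-isolated vertices
  are matched as \<open>x, \<sigma> x\<close> such that \<open>x \<le> x'\<close> iff \<open>x\<close> is adjacent to \<open>\<sigma> x'\<close> is a
  partial order (Herzog and Hibi). Grouping the independent sets by the minimal elements
  of their \<open>X\<close>-part partitions the complex into Boolean intervals indexed by the antichains of
  this poset. So \<open>h\<^sub>j\<close> counts the antichains of size \<open>j\<close>, which are the independent sets of the
  comparability graph.\<close>

section \<open>Ideals and Koszul cohomology\<close>

text \<open>The hypothesis only supplies, at each maximal ideal, regular sequences whose elements
  are unknown, so no contradiction can be read off from them directly. They are traded for the
  vanishing of cohomology that depends on the two ideals alone: a sequence of length n in M forces
  vanishing in all degrees below n. At the point of a face F contained in a face G the height is at
  least \<open>card G\<close>, so vanishing holds below \<open>card G\<close>. No localisation is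
  formed: the variables of F are set to 1 by dividing by \<open>var v - 1\<close>, a nonzerodivisor
  at each stage, and every such step costs one degree. For the ring of the link this leaves
  vanishing below \<open>card G - card F\<close>, and a disconnected link violates it in degree 1.
  On the graph side the obstacle is transitivity. Splitting off a leaf y with its neighbour x makes
  x minimal and refers all comparisons among the other elements to the smaller graph, but it does
  not control what lies above x. A second use of the induction hypothesis, for the link of x itself,
  settles this by counting.\<close>

lemma ideal_addD:
  assumes "is_ideal J" "x \<in> J" "y \<in> J"
  shows "x + y \<in> J"
proof -
  have "0 - y \<in> J" using assms unfolding is_ideal_def by blast
  then have "x - (0 - y) \<in> J" using assms unfolding is_ideal_def by blast
  then show ?thesis by simp
qed

lemma ideal_diffD: "is_ideal J \<Longrightarrow> x \<in> J \<Longrightarrow> y \<in> J \<Longrightarrow> x - y \<in> J"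
  unfolding is_ideal_def by blast

lemma ideal_multD: "is_ideal J \<Longrightarrow> x \<in> J \<Longrightarrow> r * x \<in> J"
  unfolding is_ideal_def by blast

lemma ideal_zeroD: "is_ideal J \<Longrightarrow> 0 \<in> J"
  unfolding is_ideal_def by blast

lemma ideal_sumD: "is_ideal J \<Longrightarrow> (\<And>a. a \<in> F \<Longrightarrow> f a \<in> J) \<Longrightarrow> sum f F \<in> J"
  by (induction F rule: infinite_finite_induct) (auto intro: ideal_addD ideal_zeroD)

lemma is_ideal_ideal_gen: "is_ideal (ideal_gen A)"
  unfolding is_ideal_def
proof (intro conjI ballI allI)
  show "0 \<in> ideal_gen A"
    unfolding ideal_gen_def by (auto intro!: exI[of _ "{}"])
next
  fix x y assume "x \<in> ideal_gen A" "y \<in> ideal_gen A"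
  then obtain F c G d where
    F: "finite F" "F \<subseteq> A" "x = (\<Sum>a\<in>F. c a * a)" and
    G: "finite G" "G \<subseteq> A" "y = (\<Sum>a\<in>G. d a * a)"
    unfolding ideal_gen_def by blast
  let ?e = "\<lambda>a. (if a \<in> F then c a else 0) - (if a \<in> G then d a else 0)"
  have "x = (\<Sum>a\<in>F \<union> G. (if a \<in> F then c a else 0) * a)"
    using F(1) G(1) unfolding F(3) by (intro sum.mono_neutral_cong_left) auto
  moreover have "y = (\<Sum>a\<in>F \<union> G. (if a \<in> G then d a else 0) * a)"
    using F(1) G(1) unfolding G(3) by (intro sum.mono_neutral_cong_left) auto
  ultimately have "x - y = (\<Sum>a\<in>F \<union> G. ?e a * a)"
    by (simp add: sum_subtractf left_diff_distrib)
  moreover have "finite (F \<union> G)" "F \<union> G \<subseteq> A" using F G by auto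
  ultimately show "x - y \<in> ideal_gen A"
    unfolding ideal_gen_def mem_Collect_eq
    by (intro exI[of _ "F \<union> G"] exI[of _ ?e] conjI)
next
  fix r x assume "x \<in> ideal_gen A"
  then obtain F c where F: "finite F" "F \<subseteq> A" "x = (\<Sum>a\<in>F. c a * a)"
    unfolding ideal_gen_def by blast
  then have "r * x = (\<Sum>a\<in>F. (r * c a) * a)"
    by (simp add: sum_distrib_left mult.assoc)
  then show "r * x \<in> ideal_gen A"
    unfolding ideal_gen_def mem_Collect_eq
    using F by (intro exI[of _ F] exI[of _ "\<lambda>a. r * c a"] conjI) auto
qed

lemma ideal_gen_superset: "A \<subseteq> ideal_gen A"
proof
  fix a assume "a \<in> A"
  then show "a \<in> ideal_gen A"
    unfolding ideal_gen_def mem_Collect_eq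
    by (intro exI[of _ "{a}"] exI[of _ "\<lambda>_. 1"]) auto
qed

lemma ideal_gen_least: "is_ideal J \<Longrightarrow> A \<subseteq> J \<Longrightarrow> ideal_gen A \<subseteq> J"
  unfolding ideal_gen_def by (auto intro!: ideal_sumD ideal_multD)

lemma ideal_gen_mono: "A \<subseteq> B \<Longrightarrow> ideal_gen A \<subseteq> ideal_gen B"
  by (intro ideal_gen_least is_ideal_ideal_gen) (use ideal_gen_superset in blast)

lemma ideal_gen_ideal: "is_ideal J \<Longrightarrow> ideal_gen J = J"
  using ideal_gen_least[of J J] ideal_gen_superset[of J] by blast

section \<open>Ideals enlarged by one element\<close>

definition add_gen :: "'a::comm_ring_1 set \<Rightarrow> 'a \<Rightarrow> 'a set" where
  "add_gen J x = {j + x * e | j e. j \<in> J}"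

lemma add_genD:
  assumes "u \<in> add_gen J x"
  shows "\<exists>e. u - x * e \<in> J"
proof -
  obtain j e where "u = j + x * e" "j \<in> J" using assms unfolding add_gen_def by blast
  then have "u - x * e \<in> J" by simp
  then show ?thesis ..
qed

lemma add_genI:
  assumes "u - x * e \<in> J"
  shows "u \<in> add_gen J x"
proof -
  have "u = (u - x * e) + x * e" by simp
  with assms show ?thesis unfolding add_gen_def by blast
qed

lemma is_ideal_add_gen:
  assumes "is_ideal J"
  shows "is_ideal (add_gen J x)"
  unfolding is_ideal_def
proof (intro conjI ballI allI)
  show "0 \<in> add_gen J x"
    unfolding add_gen_def mem_Collect_eq
    by (rule exI[of _ 0], rule exI[of _ 0]) (simp add: ideal_zeroD[OF assms])
next
  fix u v assume "u \<in> add_gen J x" "v \<in> add_gen J x"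
  then obtain j e k d where "u = j + x * e" "j \<in> J" "v = k + x * d" "k \<in> J"
    unfolding add_gen_def by blast
  then have "u - v = (j - k) + x * (e - d) \<and> j - k \<in> J"
    using ideal_diffD[OF assms] by (simp add: algebra_simps)
  then show "u - v \<in> add_gen J x" unfolding add_gen_def by blast
next
  fix r u assume "u \<in> add_gen J x"
  then obtain j e where "u = j + x * e" "j \<in> J"
    unfolding add_gen_def by blast
  then have "r * u = r * j + x * (r * e) \<and> r * j \<in> J"
    using ideal_multD[OF assms] by (simp add: algebra_simps)
  then show "r * u \<in> add_gen J x" unfolding add_gen_def by blast
qed

lemma ideal_gen_insert: "ideal_gen (insert x A) = add_gen (ideal_gen A) x"
proof
  have "A \<subseteq> add_gen (ideal_gen A) x"
  proof
    fix a assume "a \<in> A"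
    then have "a \<in> ideal_gen A" "a = a + x * 0" using ideal_gen_superset by auto
    then show "a \<in> add_gen (ideal_gen A) x" unfolding add_gen_def by blast
  qed
  moreover have "x \<in> add_gen (ideal_gen A) x"
    unfolding add_gen_def mem_Collect_eq
    by (rule exI[of _ 0], rule exI[of _ 1]) (simp add: ideal_zeroD[OF is_ideal_ideal_gen])
  ultimately show "ideal_gen (insert x A) \<subseteq> add_gen (ideal_gen A) x"
    by (intro ideal_gen_least is_ideal_add_gen is_ideal_ideal_gen) auto
  show "add_gen (ideal_gen A) x \<subseteq> ideal_gen (insert x A)"
  proof
    fix u assume "u \<in> add_gen (ideal_gen A) x"
    then obtain j e where u: "u = j + x * e" "j \<in> ideal_gen A"
      unfolding add_gen_def by blast
    have "j \<in> ideal_gen (insert x A)"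
      using u(2) ideal_gen_mono[of A "insert x A"] by blast
    moreover have "x \<in> ideal_gen (insert x A)"
      using ideal_gen_superset[of "insert x A"] by blast
    then have "e * x \<in> ideal_gen (insert x A)"
      by (intro ideal_multD is_ideal_ideal_gen)
    ultimately show "u \<in> ideal_gen (insert x A)"
      unfolding u(1) by (simp add: ideal_addD is_ideal_ideal_gen mult.commute)
  qed
qed

text \<open>The next complex is a non-alternating Koszul complex on all elements of \<open>M\<close>: cochains are
  arbitrary functions of lists over \<open>M\<close>. It has no finiteness requirements, and prepending
  \<open>x\<close> to the argument list is a homotopy from multiplication by \<open>x\<close> to zero. So its
  cohomology detects regular sequences without any Noetherian input.\<close>

fun kdiff :: "('a::comm_ring_1 list \<Rightarrow> 'a) \<Rightarrow> 'a list \<Rightarrow> 'a" where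
  "kdiff f [] = 0"
| "kdiff f (a # as) = a * f as - kdiff (\<lambda>bs. f (a # bs)) as"

lemma kdiff_diff: "kdiff (\<lambda>bs. f bs - g bs) as = kdiff f as - kdiff g as"
  by (induction as arbitrary: f g) (simp_all add: algebra_simps)

lemma kdiff_scale: "kdiff (\<lambda>bs. x * f bs) as = x * kdiff f as"
  by (induction as arbitrary: f) (simp_all add: algebra_simps)

lemma kdiff_kdiff: "kdiff (kdiff f) as = 0"
proof (induction as arbitrary: f)
  case (Cons a as)
  have "kdiff (\<lambda>bs. kdiff f (a # bs)) as = a * kdiff f as - kdiff (kdiff (\<lambda>bs. f (a # bs))) as"
    by (simp add: kdiff_diff kdiff_scale)
  then show ?case using Cons.IH by simp
qed simp

lemma kdiff_mem:
  assumes "is_ideal J"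
    and "\<And>bs. length as = Suc (length bs) \<Longrightarrow> set bs \<subseteq> set as \<Longrightarrow> f bs \<in> J"
  shows "kdiff f as \<in> J"
  using assms(2)
proof (induction as arbitrary: f)
  case Nil
  then show ?case using ideal_zeroD[OF assms(1)] by simp
next
  case (Cons a as)
  have "kdiff (\<lambda>bs. f (a # bs)) as \<in> J"
    by (rule Cons.IH) (auto intro!: Cons.prems)
  moreover have "f as \<in> J" by (auto intro!: Cons.prems)
  ultimately show ?case using assms(1) by (simp add: ideal_diffD ideal_multD)
qed

text \<open>Length and entries are restricted here and not in the type: a k-cochain is a total
  function, and what counts are its values on lists of length k over \<open>M\<close>, read modulo
  \<open>J\<close>.\<close>

definition kcocycle :: "'a::comm_ring_1 set \<Rightarrow> 'a set \<Rightarrow> nat \<Rightarrow> ('a list \<Rightarrow> 'a) \<Rightarrow> bool" where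
  "kcocycle M J k f \<longleftrightarrow> (\<forall>as. length as = Suc k \<and> set as \<subseteq> M \<longrightarrow> kdiff f as \<in> J)"

definition kcobound :: "'a::comm_ring_1 set \<Rightarrow> 'a set \<Rightarrow> nat \<Rightarrow> ('a list \<Rightarrow> 'a) \<Rightarrow> bool" where
  "kcobound M J k f \<longleftrightarrow> (\<exists>g. \<forall>as. length as = k \<and> set as \<subseteq> M \<longrightarrow> f as - kdiff g as \<in> J)"

definition kvanish :: "'a::comm_ring_1 set \<Rightarrow> 'a set \<Rightarrow> nat \<Rightarrow> bool" where
  "kvanish M J k \<longleftrightarrow> (\<forall>f. kcocycle M J k f \<longrightarrow> kcobound M J k f)"

text \<open>For a cocycle f the homotopy gives x f = d hf modulo J. So hf is a cocycle of one degree
  less modulo J + (x), hence hf = d g + x e modulo J. Applying d yields x f = x d e, and x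
  cancels.\<close>

lemma kvanish_from_quotient:
  assumes J: "is_ideal J" and x: "x \<in> M" and reg: "\<And>y. x * y \<in> J \<Longrightarrow> y \<in> J"
    and van: "\<And>i. i < n \<Longrightarrow> kvanish M (add_gen J x) i" and k: "k < Suc n"
  shows "kvanish M J k"
  unfolding kvanish_def
proof (intro allI impI)
  fix f assume f: "kcocycle M J k f"
  define hf where "hf = (\<lambda>bs. f (x # bs))"
  have hom: "x * f as - kdiff hf as \<in> J" if "length as = k" "set as \<subseteq> M" for as
  proof -
    have "kdiff f (x # as) \<in> J"
      using f that x unfolding kcocycle_def by (metis insert_subset length_Cons list.set(2))
    then show ?thesis by (simp add: hf_def)
  qed
  show "kcobound M J k f"
  proof (cases k)
    case 0
    then have "f [] \<in> J" using hom[of "[]"] reg by simp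
    then show ?thesis using 0 unfolding kcobound_def by auto
  next
    case (Suc i)
    have "kcocycle M (add_gen J x) i hf"
      unfolding kcocycle_def
    proof (intro allI impI)
      fix as assume as: "length as = Suc i \<and> set as \<subseteq> M"
      have "0 - (x * f as - kdiff hf as) \<in> J"
        by (rule ideal_diffD[OF J ideal_zeroD[OF J]]) (use hom as Suc in auto)
      then show "kdiff hf as \<in> add_gen J x" by (intro add_genI[of _ _ "f as"]) simp
    qed
    then have "kcobound M (add_gen J x) i hf"
      using van[of i] k Suc unfolding kvanish_def by auto
    then obtain g where g: "\<And>as. length as = i \<Longrightarrow> set as \<subseteq> M \<Longrightarrow> hf as - kdiff g as \<in> add_gen J x"
      unfolding kcobound_def by blast
    have "\<exists>e. length as = i \<and> set as \<subseteq> M \<longrightarrow> hf as - kdiff g as - x * e \<in> J" for as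
      using add_genD g by blast
    then obtain e where e: "\<And>as. length as = i \<Longrightarrow> set as \<subseteq> M \<Longrightarrow> hf as - kdiff g as - x * e as \<in> J"
      by metis
    have "f as - kdiff e as \<in> J" if as: "length as = k" "set as \<subseteq> M" for as
    proof -
      have "kdiff (\<lambda>bs. hf bs - kdiff g bs - x * e bs) as \<in> J"
        by (rule kdiff_mem[OF J]) (use as Suc e in auto)
      then have "kdiff hf as - x * kdiff e as \<in> J"
        by (simp add: kdiff_diff kdiff_scale kdiff_kdiff)
      then have "(x * f as - kdiff hf as) + (kdiff hf as - x * kdiff e as) \<in> J"
        using hom as by (intro ideal_addD[OF J]) auto
      then have "x * (f as - kdiff e as) \<in> J" by (simp add: algebra_simps)
      then show ?thesis by (rule reg)
    qed
    then show ?thesis unfolding kcobound_def by blast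
  qed
qed

text \<open>The piece H^k(S/J), H^k(S/(J + (a))), H^(k+1)(S/J) of the long exact sequence, chased by
  hand: g represents the image of f under the connecting map, and writing g = d e shows that f - a e
  is a cocycle modulo J.\<close>

lemma kvanish_quotient:
  assumes J: "is_ideal J" and reg: "\<And>y. a * y \<in> J \<Longrightarrow> y \<in> J"
    and v0: "kvanish M J k" and v1: "kvanish M J (Suc k)"
  shows "kvanish M (add_gen J a) k"
  unfolding kvanish_def
proof (intro allI impI)
  fix f assume f: "kcocycle M (add_gen J a) k f"
  have "\<exists>g. length as = Suc k \<and> set as \<subseteq> M \<longrightarrow> kdiff f as - a * g \<in> J" for as
    using f add_genD unfolding kcocycle_def by blast
  then obtain g where g: "\<And>as. length as = Suc k \<Longrightarrow> set as \<subseteq> M \<Longrightarrow> kdiff f as - a * g as \<in> J"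
    by metis
  have "kcocycle M J (Suc k) g"
    unfolding kcocycle_def
  proof (intro allI impI)
    fix as assume as: "length as = Suc (Suc k) \<and> set as \<subseteq> M"
    have "kdiff (\<lambda>bs. kdiff f bs - a * g bs) as \<in> J"
      by (rule kdiff_mem[OF J]) (use as g in auto)
    then have "0 - a * kdiff g as \<in> J"
      by (simp add: kdiff_diff kdiff_scale kdiff_kdiff)
    from ideal_diffD[OF J ideal_zeroD[OF J] this] have "a * kdiff g as \<in> J" by simp
    then show "kdiff g as \<in> J" by (rule reg)
  qed
  then have "kcobound M J (Suc k) g" using v1 unfolding kvanish_def by blast
  then obtain e where e: "\<And>as. length as = Suc k \<Longrightarrow> set as \<subseteq> M \<Longrightarrow> g as - kdiff e as \<in> J"
    unfolding kcobound_def by blast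
  have "kcocycle M J k (\<lambda>bs. f bs - a * e bs)"
    unfolding kcocycle_def
  proof (intro allI impI)
    fix as assume as: "length as = Suc k \<and> set as \<subseteq> M"
    have "(kdiff f as - a * g as) + a * (g as - kdiff e as) \<in> J"
      using as by (intro ideal_addD[OF J] ideal_multD[OF J] g e) auto
    then show "kdiff (\<lambda>bs. f bs - a * e bs) as \<in> J"
      by (simp add: kdiff_diff kdiff_scale algebra_simps)
  qed
  then have "kcobound M J k (\<lambda>bs. f bs - a * e bs)" using v0 unfolding kvanish_def by blast
  then obtain h where h: "\<And>as. length as = k \<Longrightarrow> set as \<subseteq> M \<Longrightarrow> f as - a * e as - kdiff h as \<in> J"
    unfolding kcobound_def by blast
  have "f as - kdiff h as \<in> add_gen J a" if "length as = k" "set as \<subseteq> M" for as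
  proof -
    have "f as - kdiff h as = (f as - a * e as - kdiff h as) + a * e as" by simp
    then show ?thesis using h[OF that] unfolding add_gen_def by blast
  qed
  then show "kcobound M (add_gen J a) k f" unfolding kcobound_def by blast
qed

lemma regular_seq_kvanish:
  assumes "quot_regular_seq J xs" "set xs \<subseteq> M" "is_ideal J" "k < length xs"
  shows "kvanish M J k"
  using assms
proof (induction xs arbitrary: J k)
  case (Cons x xs)
  \<comment> \<open>Regularity is phrased through generated ideals; this identity lets the head of
    the sequence be absorbed into the ideal, so that the tail is regular over
    \<open>add_gen J x\<close>.\<close>
  have gen: "ideal_gen (insert x J \<union> A) = ideal_gen (add_gen J x \<union> A)" for A
  proof
    have *: "insert x J \<subseteq> add_gen J x" "add_gen J x \<subseteq> ideal_gen (insert x J)"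
      using ideal_gen_insert[of x J] ideal_gen_ideal[OF Cons.prems(3)]
        ideal_gen_superset[of "insert x J"] by auto
    show "ideal_gen (insert x J \<union> A) \<subseteq> ideal_gen (add_gen J x \<union> A)"
      using * by (intro ideal_gen_mono) auto
    have "ideal_gen (insert x J) \<subseteq> ideal_gen (insert x J \<union> A)"
      by (intro ideal_gen_mono) auto
    then show "ideal_gen (add_gen J x \<union> A) \<subseteq> ideal_gen (insert x J \<union> A)"
      using * ideal_gen_superset[of "insert x J \<union> A"]
      by (intro ideal_gen_least is_ideal_ideal_gen) auto
  qed
  have reg: "y \<in> J" if "x * y \<in> J" for y
    using Cons.prems(1) that unfolding quot_regular_seq_def
    by (auto simp: ideal_gen_ideal[OF Cons.prems(3)])
  have "quot_regular_seq (add_gen J x) xs"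
    unfolding quot_regular_seq_def
  proof (intro conjI allI impI)
    fix i y assume i: "i < length xs" "xs ! i * y \<in> ideal_gen (add_gen J x \<union> set (take i xs))"
    have "\<forall>y. (x # xs) ! Suc i * y \<in> ideal_gen (J \<union> set (take (Suc i) (x # xs))) \<longrightarrow>
        y \<in> ideal_gen (J \<union> set (take (Suc i) (x # xs)))"
      using Cons.prems(1) i(1) unfolding quot_regular_seq_def by (metis Suc_less_eq length_Cons)
    then show "y \<in> ideal_gen (add_gen J x \<union> set (take i xs))"
      using i(2) gen[of "set (take i xs)"] by simp
  next
    show "ideal_gen (add_gen J x \<union> set xs) \<noteq> UNIV"
      using Cons.prems(1) gen[of "set xs"] unfolding quot_regular_seq_def by simp
  qed
  then have "kvanish M (add_gen J x) i" if "i < length xs" for i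
    using Cons.IH Cons.prems that is_ideal_add_gen by auto
  then show ?case
    using kvanish_from_quotient[OF Cons.prems(3) _ reg, of x M "length xs" k] Cons.prems by auto
qed simp

section \<open>Polynomials and their specialisations\<close>

lemma sum_lookup_single:
  fixes m :: "'v::finite \<Rightarrow>\<^sub>0 nat"
  shows "(\<Sum>v\<in>UNIV. Poly_Mapping.single v (Poly_Mapping.lookup m v)) = m"
proof (rule poly_mapping_eqI)
  fix k
  have "(\<Sum>v\<in>UNIV. Poly_Mapping.lookup m v when v = k) = (\<Sum>v\<in>UNIV. if v =
      k then Poly_Mapping.lookup m k else 0)"
    by (rule sum.cong) (auto simp: when_def)
  then show "Poly_Mapping.lookup (\<Sum>v\<in>UNIV. Poly_Mapping.single v (Poly_Mapping.lookup m v)) k =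
      Poly_Mapping.lookup m k"
    by (simp add: lookup_sum lookup_single)
qed

lemma mpoly_eq_sum_single: "p = (\<Sum>m\<in>Poly_Mapping.keys p. Poly_Mapping.single m (Poly_Mapping.lookup p m))"
proof (rule poly_mapping_eqI)
  fix k
  have "(\<Sum>m\<in>Poly_Mapping.keys p. Poly_Mapping.lookup p m when m = k) =
      (\<Sum>m\<in>Poly_Mapping.keys p. if m = k then Poly_Mapping.lookup p k else 0)"
    by (rule sum.cong) (auto simp: when_def)
  then show "Poly_Mapping.lookup p k = Poly_Mapping.lookup
      (\<Sum>m\<in>Poly_Mapping.keys p. Poly_Mapping.single m (Poly_Mapping.lookup p m)) k"
    by (auto simp: lookup_sum lookup_single in_keys_iff)
qed

section \<open>Evaluation homomorphisms of the polynomial ring\<close>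

definition var :: "'v \<Rightarrow> ('v, 'k::field) mpoly" where
  "var v = Poly_Mapping.single (Poly_Mapping.single v 1) 1"

definition cst :: "'k \<Rightarrow> ('v, 'k::field) mpoly" where
  "cst c = Poly_Mapping.single 0 c"

lemma var_power: "var v ^ n = Poly_Mapping.single (Poly_Mapping.single v n) 1"
  by (induction n) (simp_all add: var_def mult_single single_add[symmetric])

lemma prod_var_power:
  "(\<Prod>v\<in>A. var (g v) ^ k v) = Poly_Mapping.single (\<Sum>v\<in>A. Poly_Mapping.single (g v) (k v)) 1"
  by (induction A rule: infinite_finite_induct) (simp_all add: var_power mult_single)

lemma single_eq_cst_prod:
  "Poly_Mapping.single m c = cst c * (\<Prod>v\<in>UNIV. var (v::'v::finite) ^ Poly_Mapping.lookup m v)"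
  by (simp add: cst_def mult_single sum_lookup_single
      prod_var_power[of "\<lambda>v. v" "Poly_Mapping.lookup m" UNIV])

lemma cst_0 [simp]: "cst 0 = 0" and cst_1 [simp]: "cst 1 = 1"
  and cst_add: "cst (x + y) = cst x + cst y" and cst_mult: "cst (x * y) = cst x * cst y"
  by (simp_all add: cst_def single_add mult_single)

definition ring_hom :: "('a::comm_ring_1 \<Rightarrow> 'b::comm_ring_1) \<Rightarrow> bool" where
  "ring_hom h \<longleftrightarrow> h 1 = 1 \<and> (\<forall>x y. h (x + y) = h x + h y) \<and> (\<forall>x y. h (x * y) = h x * h y)"

lemma ring_hom_1: "ring_hom h \<Longrightarrow> h 1 = 1"
  and ring_hom_add: "ring_hom h \<Longrightarrow> h (x + y) = h x + h y"
  and ring_hom_mult: "ring_hom h \<Longrightarrow> h (x * y) = h x * h y"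
  unfolding ring_hom_def by auto

lemma ring_hom_0: "ring_hom h \<Longrightarrow> h 0 = 0"
  using ring_hom_add[of h 0 0] by simp

lemma ring_hom_diff: "ring_hom h \<Longrightarrow> h (x - y) = h x - h y"
  using ring_hom_add[of h "x - y" y] by simp

lemma ring_hom_sum: "ring_hom h \<Longrightarrow> h (sum f A) = (\<Sum>a\<in>A. h (f a))"
  by (induction A rule: infinite_finite_induct) (simp_all add: ring_hom_0 ring_hom_add)

lemma ring_hom_power: "ring_hom h \<Longrightarrow> h (x ^ n) = h x ^ n"
  by (induction n) (simp_all add: ring_hom_1 ring_hom_mult)

lemma ring_hom_prod: "ring_hom h \<Longrightarrow> h (prod f A) = (\<Prod>a\<in>A. h (f a))"
  by (induction A rule: infinite_finite_induct) (simp_all add: ring_hom_1 ring_hom_mult)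

lemma ring_hom_comp: "ring_hom g \<Longrightarrow> ring_hom h \<Longrightarrow> ring_hom (\<lambda>x. g (h x))"
  unfolding ring_hom_def by simp

lemma ring_hom_cst: "ring_hom cst"
  unfolding ring_hom_def by (simp add: cst_add cst_mult)

lemma is_ideal_kernel: "ring_hom h \<Longrightarrow> is_ideal {x. h x = 0}"
  unfolding is_ideal_def by (simp add: ring_hom_0 ring_hom_diff ring_hom_mult)

definition mpoly_eval :: "('k::field \<Rightarrow> 'b::comm_ring_1) \<Rightarrow> ('v::finite \<Rightarrow> 'b) \<Rightarrow> ('v, 'k) mpoly \<Rightarrow>
    'b" where
  "mpoly_eval c a p = (\<Sum>m\<in>Poly_Mapping.keys p. c (Poly_Mapping.lookup p m) * (\<Prod>v\<in>UNIV. a v ^ Poly_Mapping.lookup m v))"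

lemma mpoly_eval_single:
  "ring_hom c \<Longrightarrow> mpoly_eval c a (Poly_Mapping.single m x) =
      c x * (\<Prod>v\<in>UNIV. a v ^ Poly_Mapping.lookup m v)"
  by (simp add: mpoly_eval_def ring_hom_0)

lemma mpoly_eval_add: "ring_hom c \<Longrightarrow> mpoly_eval c a (p + q) = mpoly_eval c a p + mpoly_eval c a q"
  unfolding mpoly_eval_def
  by (rule setsum_keys_plus_distrib) (simp_all add: ring_hom_0 ring_hom_add distrib_right)

lemma mpoly_eval_sum: "ring_hom c \<Longrightarrow> mpoly_eval c a (sum f A) = (\<Sum>x\<in>A. mpoly_eval c a (f x))"
  by (induction A rule: infinite_finite_induct) (simp_all add: mpoly_eval_add, simp_all add: mpoly_eval_def)

lemma ring_hom_mpoly_eval: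
  assumes c: "ring_hom c"
  shows "ring_hom (mpoly_eval c a)"
  unfolding ring_hom_def
proof (intro conjI allI)
  show "mpoly_eval c a 1 = 1"
    using mpoly_eval_single[OF c, of a 0 1] by (simp add: ring_hom_1[OF c])
next
  fix p q
  show "mpoly_eval c a (p + q) = mpoly_eval c a p + mpoly_eval c a q" by (rule mpoly_eval_add[OF c])
  let ?s = "\<lambda>p m. Poly_Mapping.single m (Poly_Mapping.lookup p m)"
  have s: "mpoly_eval c a (?s p m * ?s q n) = mpoly_eval c a (?s p m) * mpoly_eval c a (?s q n)"
      for m n
    by (simp add: mult_single mpoly_eval_single[OF c] ring_hom_mult[OF c] lookup_add power_add
        prod.distrib ac_simps)
  have "mpoly_eval c a (p * q) = mpoly_eval c a ((\<Sum>m\<in>Poly_Mapping.keys p. ?s p m) *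
      (\<Sum>n\<in>Poly_Mapping.keys q. ?s q n))"
    using mpoly_eq_sum_single[of p] mpoly_eq_sum_single[of q] by simp
  also have "\<dots> = (\<Sum>m\<in>Poly_Mapping.keys p. \<Sum>n\<in>Poly_Mapping.keys q. mpoly_eval c a (?s p m) * mpoly_eval c a (?s q n))"
    by (simp add: sum_product mpoly_eval_sum[OF c] s)
  also have "\<dots> = mpoly_eval c a (\<Sum>m\<in>Poly_Mapping.keys p. ?s p m) * mpoly_eval c a
      (\<Sum>n\<in>Poly_Mapping.keys q. ?s q n)"
    by (simp add: sum_product mpoly_eval_sum[OF c])
  finally show "mpoly_eval c a (p * q) = mpoly_eval c a p * mpoly_eval c a q"
    using mpoly_eq_sum_single[of p] mpoly_eq_sum_single[of q] by simp
qed

lemma mpoly_eval_cst: "ring_hom c \<Longrightarrow> mpoly_eval c a (cst x) = c x"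
  unfolding cst_def by (simp add: mpoly_eval_single)

lemma mpoly_eval_var:
  assumes "ring_hom c"
  shows "mpoly_eval c a (var v) = a v"
proof -
  have "(\<Prod>w\<in>UNIV. a w ^ (1 when v = w)) = (\<Prod>w\<in>UNIV. if w = v then a v else 1)"
    by (rule prod.cong) auto
  then show ?thesis
    by (simp add: var_def mpoly_eval_single[OF assms] lookup_single ring_hom_1[OF assms])
qed

lemma ring_hom_eq_mpoly_eval:
  assumes "ring_hom h" "\<And>x. h (cst x) = c x" "\<And>v. h (var v) = a v"
  shows "h p = mpoly_eval c a p"
proof -
  have "h p = h (\<Sum>m\<in>Poly_Mapping.keys p. Poly_Mapping.single m (Poly_Mapping.lookup p m))"
    using mpoly_eq_sum_single[of p] by simp
  also have "\<dots> = mpoly_eval c a p"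
    unfolding single_eq_cst_prod mpoly_eval_def
    by (simp add: ring_hom_sum ring_hom_mult ring_hom_prod ring_hom_power assms)
  finally show ?thesis .
qed

lemma mpoly_induct [case_names cst var add mult]:
  fixes p :: "('v::finite, 'k::field) mpoly"
  assumes "\<And>c. P (cst c)" "\<And>v. P (var v)"
    and add: "\<And>p q. P p \<Longrightarrow> P q \<Longrightarrow> P (p + q)" and mult: "\<And>p q. P p \<Longrightarrow> P q \<Longrightarrow> P (p * q)"
  shows "P p"
proof -
  have pow: "P (var v ^ n)" for v n
    by (induction n) (use assms(1)[of 1] assms(2) mult in auto)
  have prd: "P (\<Prod>v\<in>A. var v ^ k v)" for A k
    by (induction A rule: infinite_finite_induct) (use assms(1)[of 1] pow mult in auto)
  have sm: "P (\<Sum>m\<in>A. f m)" if "\<And>m. P (f m)" for A and f :: "('v \<Rightarrow>\<^sub>0 nat) \<Rightarrow> _"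
    by (induction A rule: infinite_finite_induct) (use assms(1)[of 0] add that in auto)
  have "P (\<Sum>m\<in>Poly_Mapping.keys p. Poly_Mapping.single m (Poly_Mapping.lookup p m))"
    unfolding single_eq_cst_prod by (intro sm mult assms(1) prd)
  then show ?thesis using mpoly_eq_sum_single[of p] by simp
qed

text \<open>The library proves that polynomials form a domain only for linearly ordered sets of
  variables, so the variables are first renamed to natural numbers.\<close>

lemma mpoly_no_zero_divisors:
  fixes p q :: "('v::finite, 'k::field) mpoly"
  assumes "p * q = 0"
  shows "p = 0 \<or> q = 0"
proof -
  obtain \<iota> :: "'v \<Rightarrow> nat" where \<iota>: "inj \<iota>"
    using finite_imp_inj_to_nat_seg[of "UNIV :: 'v set"] by auto
  define \<eta> :: "('v, 'k) mpoly \<Rightarrow> (nat, 'k) mpoly" where "\<eta> = mpoly_eval cst (\<lambda>v. var (\<iota> v))"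
  define push :: "('v \<Rightarrow>\<^sub>0 nat) \<Rightarrow> (nat \<Rightarrow>\<^sub>0 nat)"
    where "push m = (\<Sum>v\<in>UNIV. Poly_Mapping.single (\<iota> v) (Poly_Mapping.lookup m v))" for m
  have lookup_push: "Poly_Mapping.lookup (push m) (\<iota> w) = Poly_Mapping.lookup m w" for m w
  proof -
    have "Poly_Mapping.lookup (push m) (\<iota> w) = (\<Sum>v\<in>UNIV. Poly_Mapping.lookup m v when \<iota> v = \<iota> w)"
      by (simp add: push_def lookup_sum lookup_single)
    also have "\<dots> = (\<Sum>v\<in>UNIV. if v = w then Poly_Mapping.lookup m w else 0)"
      by (rule sum.cong) (use \<iota> in \<open>auto simp: when_def inj_eq\<close>)
    finally show ?thesis by simp
  qed
  have inj_push: "push m = push n \<longleftrightarrow> m = n" for m n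
    by (metis lookup_push poly_mapping_eqI)
  have hom: "ring_hom \<eta>" unfolding \<eta>_def by (rule ring_hom_mpoly_eval[OF ring_hom_cst])
  have \<eta>: "\<eta> p = (\<Sum>m\<in>Poly_Mapping.keys p. Poly_Mapping.single (push m) (Poly_Mapping.lookup p m))"
      for p
    unfolding \<eta>_def mpoly_eval_def prod_var_power push_def by (simp add: cst_def mult_single)
  have inj_\<eta>: "p = 0" if "\<eta> p = 0" for p
  proof (rule poly_mapping_eqI)
    fix m
    have "Poly_Mapping.lookup (\<eta> p) (push m) =
        (\<Sum>n\<in>Poly_Mapping.keys p. Poly_Mapping.lookup p n when push n = push m)"
      by (simp add: \<eta> lookup_sum lookup_single)
    also have "\<dots> = (\<Sum>n\<in>Poly_Mapping.keys p. if n = m then Poly_Mapping.lookup p m else 0)"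
      by (rule sum.cong) (auto simp: when_def inj_push)
    also have "\<dots> = Poly_Mapping.lookup p m"
      by (auto simp: in_keys_iff)
    finally show "Poly_Mapping.lookup p m = Poly_Mapping.lookup 0 m" using that by simp
  qed
  have "\<eta> p * \<eta> q = 0"
    using assms ring_hom_mult[OF hom, of p q] ring_hom_0[OF hom] by simp
  then have "\<eta> p = 0 \<or> \<eta> q = 0" by simp
  then show ?thesis using inj_\<eta> by blast
qed

lemma var_neq_1: "var v \<noteq> (1 :: ('v, 'k::field) mpoly)"
proof
  assume "var v = (1 :: ('v, 'k) mpoly)"
  then have "Poly_Mapping.keys (var v :: ('v, 'k) mpoly) = {0}" by simp
  then have "Poly_Mapping.single v (1::nat) = 0" unfolding var_def by simp
  then have "Poly_Mapping.lookup (Poly_Mapping.single v (1::nat)) v = 0" by simp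
  then show False by simp
qed

lemma var_neq_0: "var v \<noteq> (0 :: ('v, 'k::field) mpoly)"
proof
  assume "var v = (0 :: ('v, 'k) mpoly)"
  then have "Poly_Mapping.keys (var v :: ('v, 'k) mpoly) = {}" by simp
  then show False unfolding var_def by simp
qed

text \<open>\<open>F\<close> takes precedence over \<open>U\<close>. With \<open>U\<close> empty
  this is evaluation at the 0/1-point of \<open>F\<close>; with \<open>F\<close> empty it is
  restriction to the coordinate subspace of \<open>U\<close>. Values stay in the same polynomial
  ring, so composites are again specialisations.\<close>

definition specialise :: "'v::finite set \<Rightarrow> 'v set \<Rightarrow> ('v, 'k::field) mpoly \<Rightarrow> ('v, 'k) mpoly" where
  "specialise F U = mpoly_eval cst (\<lambda>v. if v \<in> F then 1 else if v \<in> U then var v else 0)"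

lemma ring_hom_specialise: "ring_hom (specialise F U)"
  unfolding specialise_def by (rule ring_hom_mpoly_eval[OF ring_hom_cst])

lemmas specialise_hom =
  ring_hom_0[OF ring_hom_specialise] ring_hom_1[OF ring_hom_specialise] ring_hom_add[OF ring_hom_specialise]
  ring_hom_diff[OF ring_hom_specialise] ring_hom_mult[OF ring_hom_specialise]

lemma specialise_cst [simp]: "specialise F U (cst c) = cst c"
  unfolding specialise_def by (rule mpoly_eval_cst[OF ring_hom_cst])

lemma specialise_var: "specialise F U (var v) = (if v \<in> F then 1 else if v \<in> U then var v else 0)"
  unfolding specialise_def by (rule mpoly_eval_var[OF ring_hom_cst])

lemma specialise_cong: "F = F' \<Longrightarrow> U - F = U' - F \<Longrightarrow> specialise F U p = specialise F' U' p"
  unfolding specialise_def by (rule arg_cong[where f =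
      "\<lambda>a. mpoly_eval cst a p"]) (auto simp: fun_eq_iff)

lemma specialise_specialise: "specialise F U (specialise F' U' p) =
    specialise (F' \<union> (U' \<inter> F)) (U' \<inter> U) p"
proof -
  have "ring_hom (\<lambda>p. specialise F U (specialise F' U' p))"
    by (rule ring_hom_comp) (rule ring_hom_specialise)+
  then show ?thesis unfolding specialise_def[of "F' \<union> (U' \<inter> F)"]
    by (rule ring_hom_eq_mpoly_eval) (auto simp: specialise_var specialise_hom)
qed

text \<open>Setting variables to zero deletes monomials and alters no remaining coefficient, so
  vanishing on a coordinate subspace can be tested monomial by monomial.\<close>

lemma lookup_specialise:
  fixes p :: "('v::finite, 'k::field) mpoly"
  shows "Poly_Mapping.lookup (specialise {} G p) m =
    (if Poly_Mapping.keys m \<subseteq> G then Poly_Mapping.lookup p m else 0)"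
proof -
  have mon: "(\<Prod>v\<in>UNIV. (if v \<in> G then var v else 0) ^ Poly_Mapping.lookup n v) =
      (if Poly_Mapping.keys n \<subseteq> G then Poly_Mapping.single n 1 else 0 :: ('v, 'k) mpoly)" for n ::
          "'v \<Rightarrow>\<^sub>0 nat"
  proof (cases "Poly_Mapping.keys n \<subseteq> G")
    case True
    then have "v \<in> G \<or> Poly_Mapping.lookup n v = 0" for v by (auto simp: in_keys_iff)
    then have "(if v \<in> G then var v else 0) ^ Poly_Mapping.lookup n v =
        (var v ^ Poly_Mapping.lookup n v :: ('v, 'k) mpoly)" for v
      by (metis power_0)
    then have "(\<Prod>v\<in>UNIV. (if v \<in> G then var v else 0) ^ Poly_Mapping.lookup n v) =
        (\<Prod>v\<in>UNIV. var v ^ Poly_Mapping.lookup n v :: ('v, 'k) mpoly)"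
      by simp
    then show ?thesis
      using True
      by (simp add: sum_lookup_single prod_var_power[of "\<lambda>v. v" "Poly_Mapping.lookup n" UNIV])
  next
    case False
    then obtain v where "Poly_Mapping.lookup n v \<noteq> 0" "v \<notin> G" by (auto simp: in_keys_iff)
    then have "(if v \<in> G then var v else 0) ^ Poly_Mapping.lookup n v = (0 :: ('v, 'k) mpoly)"
      by (simp add: power_0_left)
    then show ?thesis using False by (auto intro!: prod_zero)
  qed
  have "Poly_Mapping.lookup (specialise {} G p) m =
      (\<Sum>n\<in>Poly_Mapping.keys p. if Poly_Mapping.keys n \<subseteq> G then Poly_Mapping.lookup p n when n = m else 0)"
    unfolding specialise_def mpoly_eval_def lookup_sum
    by (intro sum.cong refl) (simp add: mon, simp add: cst_def mult_single lookup_single)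
  also have "\<dots> = (\<Sum>n\<in>Poly_Mapping.keys p. if n = m then (if Poly_Mapping.keys m \<subseteq>
      G then Poly_Mapping.lookup p m else 0) else 0)"
    by (rule sum.cong) (auto simp: when_def)
  also have "\<dots> = (if Poly_Mapping.keys m \<subseteq> G then Poly_Mapping.lookup p m else 0)"
      by (simp add: in_keys_iff)
  finally show ?thesis .
qed

section \<open>Depth at the points of the Stanley-Reisner variety\<close>

text \<open>\<open>face_ideal \<Delta> F\<close> is the Stanley-Reisner ideal plus the elements \<open>var v - 1\<close> for
  \<open>v \<in> F\<close>, so its quotient is the Stanley-Reisner ring of the link of \<open>F\<close>; \<open>face_point F\<close>
  is the maximal ideal of the 0/1-point with support \<open>F\<close>.\<close>

definition face_ideal :: "'v::finite set set \<Rightarrow> 'v set \<Rightarrow> ('v, 'k::field) mpoly set" where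
  "face_ideal \<Delta> F = {p. \<forall>G\<in>\<Delta>. F \<subseteq> G \<longrightarrow> specialise F G p = 0}"

definition face_point :: "'v::finite set \<Rightarrow> ('v, 'k::field) mpoly set" where
  "face_point F = {p. specialise F {} p = 0}"

lemma is_ideal_face_ideal: "is_ideal (face_ideal \<Delta> F)"
  unfolding is_ideal_def face_ideal_def by (simp add: specialise_hom)

lemma is_ideal_face_point: "is_ideal (face_point F)"
  unfolding face_point_def by (rule is_ideal_kernel[OF ring_hom_specialise])

lemma specialise_subset_zero:
  assumes "p \<in> face_ideal \<Delta> {}" "G \<in> \<Delta>" "F \<union> U \<subseteq> G"
  shows "specialise F U p = 0"
proof -
  have "specialise {} G p = 0" using assms(1,2) unfolding face_ideal_def by simp
  then have "specialise F U (specialise {} G p) = 0" by (simp add: specialise_hom)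
  moreover have "specialise F U (specialise {} G p) = specialise F U p"
    unfolding specialise_specialise by (rule specialise_cong) (use assms(3) in auto)
  ultimately show ?thesis by simp
qed

lemma lookup_sum_single:
  "finite F \<Longrightarrow> Poly_Mapping.lookup (\<Sum>v\<in>F. Poly_Mapping.single v (1::nat)) w = (if w
      \<in> F then 1 else 0)"
  by (simp add: lookup_sum lookup_single when_def)

text \<open>A polynomial that vanishes on the coordinate subspaces of all faces has only monomials
  whose support is a non-face, and each of these is a multiple of a generator. This replaces
  generators by a membership test through specialisations.\<close>

lemma stanley_reisner_ideal_eq:
  fixes \<Delta> :: "'v::finite set set"
  assumes down: "\<And>F G. F \<in> \<Delta> \<Longrightarrow> G \<subseteq> F \<Longrightarrow> G \<in> \<Delta>"
  shows "(stanley_reisner_ideal \<Delta> :: ('v, 'k::field) mpoly set) = face_ideal \<Delta> {}"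
proof
  show "stanley_reisner_ideal \<Delta> \<subseteq> (face_ideal \<Delta> {} :: ('v, 'k) mpoly set)"
    unfolding stanley_reisner_ideal_def
  proof (rule ideal_gen_least[OF is_ideal_face_ideal], rule subsetI)
    fix p :: "('v, 'k) mpoly" assume "p \<in> {sqfree_monomial F | F. F \<notin> \<Delta>}"
    then obtain F where F: "p = sqfree_monomial F" "F \<notin> \<Delta>" by blast
    have "specialise {} G p = 0" if "G \<in> \<Delta>" for G
    proof (rule poly_mapping_eqI)
      fix m
      have "\<not> F \<subseteq> G" using that F(2) down by blast
      moreover have "Poly_Mapping.keys (\<Sum>v\<in>F. Poly_Mapping.single v (1::nat)) = F"
        using lookup_sum_single[of F] by (auto simp: in_keys_iff split: if_splits)
      ultimately show "Poly_Mapping.lookup (specialise {} G p) m = Poly_Mapping.lookup 0 m"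
        unfolding lookup_specialise F(1) sqfree_monomial_def by (auto simp: lookup_single when_def)
    qed
    then show "p \<in> face_ideal \<Delta> {}" unfolding face_ideal_def by simp
  qed
  show "face_ideal \<Delta> {} \<subseteq> (stanley_reisner_ideal \<Delta> :: ('v, 'k) mpoly set)"
  proof
    fix p :: "('v, 'k) mpoly" assume p: "p \<in> face_ideal \<Delta> {}"
    have "Poly_Mapping.single m (Poly_Mapping.lookup p m) \<in> stanley_reisner_ideal \<Delta>"
      if m: "m \<in> Poly_Mapping.keys p" for m
    proof -
      let ?F = "Poly_Mapping.keys m"
      let ?s = "\<Sum>v\<in>?F. Poly_Mapping.single v (1::nat)"
      have "?F \<notin> \<Delta>"
      proof
        assume "?F \<in> \<Delta>"
        then have "specialise {} ?F p = 0" using p unfolding face_ideal_def by simp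
        then have "Poly_Mapping.lookup (specialise {} ?F p) m = 0" by simp
        then show False using m unfolding lookup_specialise by (simp add: in_keys_iff)
      qed
      then have "sqfree_monomial ?F \<in> (stanley_reisner_ideal \<Delta> :: ('v, 'k) mpoly set)"
        unfolding stanley_reisner_ideal_def by (intro subsetD[OF ideal_gen_superset]) auto
      then have "Poly_Mapping.single (m - ?s) (Poly_Mapping.lookup p m) * sqfree_monomial ?F
          \<in> (stanley_reisner_ideal \<Delta> :: ('v, 'k) mpoly set)"
        unfolding stanley_reisner_ideal_def by (rule ideal_multD[OF is_ideal_ideal_gen])
      moreover have "m - ?s + ?s = m"
      proof (rule poly_mapping_eqI)
        fix v
        show "Poly_Mapping.lookup (m - ?s + ?s) v = Poly_Mapping.lookup m v"
          using lookup_sum_single[of ?F v] by (auto simp: lookup_add lookup_minus in_keys_iff)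
      qed
      ultimately show ?thesis by (simp add: sqfree_monomial_def mult_single)
    qed
    then have "(\<Sum>m\<in>Poly_Mapping.keys p. Poly_Mapping.single m (Poly_Mapping.lookup p m))
        \<in> stanley_reisner_ideal \<Delta>"
      unfolding stanley_reisner_ideal_def by (rule ideal_sumD[OF is_ideal_ideal_gen])
    then show "p \<in> stanley_reisner_ideal \<Delta>" using mpoly_eq_sum_single[of p] by simp
  qed
qed

text \<open>This rule and the next carry the induction in \<open>face_ideal_insert\<close>, where p'
  is p with one variable set to 1 and x is \<open>var v - 1\<close>.\<close>

lemma sum_remainder:
  fixes x :: "'a::comm_ring_1"
  shows "p = p' + x * d \<Longrightarrow> q = q' + x * e \<Longrightarrow> p + q = p' + q' + x * (d + e)"
  by (simp add: algebra_simps)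

lemma product_remainder:
  fixes x :: "'a::comm_ring_1"
  shows "p = p' + x * d \<Longrightarrow> q = q' + x * e \<Longrightarrow> p * q = p' * q' + x * (d * q + p' * e)"
  by (simp add: algebra_simps)

lemma shifted_remainder:
  fixes x :: "'a::comm_ring_1"
  shows "p = s + (x - 1) * e \<Longrightarrow> p - (x - 1) * (e - s) = x * s"
  by (simp add: algebra_simps)

text \<open>Links are thereby reached one vertex at a time, each step being a quotient to which
  \<open>kvanish_quotient\<close> applies.\<close>

lemma face_ideal_insert:
  fixes \<Delta> :: "'v::finite set set"
  assumes "v \<notin> F"
  shows "face_ideal \<Delta> (insert v F) = add_gen (face_ideal \<Delta> F ::
      ('v, 'k::field) mpoly set) (var v - 1)"
proof
  show "add_gen (face_ideal \<Delta> F) (var v - 1) \<subseteq> (face_ideal \<Delta> (insert v F) :: ('v, 'k) mpoly set)"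
  proof
    fix p :: "('v, 'k) mpoly" assume "p \<in> add_gen (face_ideal \<Delta> F) (var v - 1)"
    then obtain j e where p: "p = j + (var v - 1) * e" and j: "j \<in> face_ideal \<Delta> F"
      unfolding add_gen_def by blast
    have "specialise (insert v F) G p = 0" if G: "G \<in> \<Delta>" "insert v F \<subseteq> G" for G
    proof -
      have "specialise F G j = 0" using j G unfolding face_ideal_def by simp
      then have "specialise (insert v F) G (specialise F G j) = 0" by (simp add: specialise_hom)
      moreover have "specialise (insert v F) G (specialise F G j) = specialise (insert v F) G j"
        unfolding specialise_specialise by (rule specialise_cong) (use G in auto)
      ultimately show ?thesis by (simp add: p specialise_hom specialise_var)
    qed
    then show "p \<in> face_ideal \<Delta> (insert v F)" unfolding face_ideal_def by simp
  qed
  show "face_ideal \<Delta> (insert v F) \<subseteq> add_gen (face_ideal \<Delta> F :: ('v, 'k) mpoly set) (var v - 1)"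
  proof
    fix p :: "('v, 'k) mpoly" assume p: "p \<in> face_ideal \<Delta> (insert v F)"
    let ?\<phi> = "specialise {v} UNIV"
    have "\<exists>e. q = ?\<phi> q + (var v - 1) * e" for q :: "('v, 'k) mpoly"
    proof (induction q rule: mpoly_induct)
      case (cst c)
      show ?case by (rule exI[of _ 0]) simp
    next
      case (var w)
      show ?case
      proof (cases "w = v")
        case True
        then show ?thesis by (intro exI[of _ 1]) (simp add: specialise_var)
      next
        case False
        then show ?thesis by (intro exI[of _ 0]) (simp add: specialise_var)
      qed
    next
      case (add p q)
      then obtain d e where "p = ?\<phi> p + (var v - 1) * d" "q = ?\<phi> q + (var v - 1) * e" by blast
      then have "p + q = ?\<phi> (p + q) + (var v - 1) * (d + e)"
        unfolding specialise_hom by (rule sum_remainder)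
      then show ?case by blast
    next
      case (mult p q)
      then obtain d e where "p = ?\<phi> p + (var v - 1) * d" "q = ?\<phi> q + (var v - 1) * e" by blast
      then have "p * q = ?\<phi> (p * q) + (var v - 1) * (d * q + ?\<phi> p * e)"
        unfolding specialise_hom by (rule product_remainder)
      then show ?case by blast
    qed
    then obtain e where e: "p = ?\<phi> p + (var v - 1) * e" by blast
    \<comment> \<open>\<open>?\<phi> p\<close> need not vanish on faces that omit \<open>v\<close>.
      The factor \<open>var v\<close> kills it there and is harmless, being congruent to 1 modulo
      \<open>var v - 1\<close>.\<close>
    have "specialise F G (var v * ?\<phi> p) = 0" if G: "G \<in> \<Delta>" "F \<subseteq> G" for G
    proof (cases "v \<in> G")
      case True
      have "specialise F G (?\<phi> p) = specialise (insert v F) G p"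
        unfolding specialise_specialise by (rule specialise_cong) auto
      also have "\<dots> = 0" using p G True unfolding face_ideal_def by simp
      finally show ?thesis by (simp add: specialise_hom)
    next
      case False
      then show ?thesis using assms by (simp add: specialise_hom specialise_var)
    qed
    then have "var v * ?\<phi> p \<in> face_ideal \<Delta> F" unfolding face_ideal_def by simp
    moreover have "p - (var v - 1) * (e - ?\<phi> p) = var v * ?\<phi> p"
      by (rule shifted_remainder) (rule e)
    ultimately show "p \<in> add_gen (face_ideal \<Delta> F) (var v - 1)"
      by (intro add_genI[of _ _ "e - ?\<phi> p"]) simp
  qed
qed

text \<open>On each face the image of \<open>var v - 1\<close> is \<open>var v - 1\<close> or -1, a
  nonzero element of a domain.\<close>

lemma face_ideal_regular:
  assumes "v \<notin> F" "(var v - 1) * p \<in> face_ideal \<Delta> F"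
  shows "p \<in> face_ideal \<Delta> F"
proof -
  have "specialise F G p = 0" if G: "G \<in> \<Delta>" "F \<subseteq> G" for G
  proof -
    have "specialise F G (var v - 1) * specialise F G p = 0"
      using assms(2) G unfolding face_ideal_def by (simp add: specialise_hom)
    moreover have "specialise F G (var v - 1) \<noteq> 0"
      using assms(1) by (simp add: specialise_hom specialise_var var_neq_1)
    ultimately show ?thesis using mpoly_no_zero_divisors by blast
  qed
  then show ?thesis unfolding face_ideal_def by simp
qed

lemma specialise_empty_is_cst: "\<exists>c. specialise F {} p = cst c"
proof (induction p rule: mpoly_induct)
  case (cst c)
  then show ?case by auto
next
  case (var v)
  then show ?case using cst_0 cst_1 by (auto simp: specialise_var intro: exI[of _ 0] exI[of _ 1])
next
  case (add p q)
  then show ?case by (auto simp: specialise_hom cst_add[symmetric])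
next
  case (mult p q)
  then show ?case by (auto simp: specialise_hom cst_mult[symmetric])
qed

lemma is_maximal_ideal_face_point: "is_maximal_ideal (face_point F)"
  unfolding is_maximal_ideal_def
proof (intro conjI allI impI)
  show "is_ideal (face_point F)" by (rule is_ideal_face_point)
  have "1 \<notin> face_point F" by (simp add: face_point_def specialise_hom)
  then show "face_point F \<noteq> UNIV" by auto
  fix J :: "('a, 'b) mpoly set" assume J: "is_ideal J \<and> face_point F \<subseteq> J"
  show "J = face_point F \<or> J = UNIV"
  proof (rule disjCI)
    assume "J \<noteq> UNIV"
    have "p \<in> face_point F" if p: "p \<in> J" for p
    proof (rule ccontr)
      assume "p \<notin> face_point F"
      obtain c where c: "specialise F {} p = cst c" using specialise_empty_is_cst by blast
      then have "c \<noteq> 0" using \<open>p \<notin> face_point F\<close> by (auto simp: face_point_def)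
      have "p - cst c \<in> face_point F" by (simp add: face_point_def specialise_hom c)
      then have "p - (p - cst c) \<in> J" using J p ideal_diffD[of J p "p - cst c"] by blast
      moreover have "p - (p - cst c) = cst c" by simp
      ultimately have "cst c \<in> J" by metis
      then have "cst (inverse c) * cst c \<in> J" using J by (intro ideal_multD) auto
      then have "1 \<in> J" using \<open>c \<noteq> 0\<close> by (simp add: cst_mult[symmetric])
      then have "q * 1 \<in> J" for q using J by (intro ideal_multD) auto
      then show False using \<open>J \<noteq> UNIV\<close> by auto
    qed
    then show "J = face_point F" using J by blast
  qed
qed

lemma is_prime_ideal_kernel_specialise: "is_prime_ideal {p. specialise F U p = 0}"
  unfolding is_prime_ideal_def
proof (intro conjI allI impI)
  show "is_ideal {p. specialise F U p = 0}" by (rule is_ideal_kernel[OF ring_hom_specialise])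
  have "1 \<notin> {p. specialise F U p = 0}" by (simp add: specialise_hom)
  then show "{p. specialise F U p = 0} \<noteq> UNIV" by blast
next
  fix a b :: "('a, 'b) mpoly" assume "a * b \<in> {p. specialise F U p = 0}"
  then show "a \<in> {p. specialise F U p = 0} \<or> b \<in> {p. specialise F U p = 0}"
    using mpoly_no_zero_divisors[of "specialise F U a" "specialise F U b"]
        by (simp add: specialise_hom)
qed

text \<open>The chain starts at the prime of the coordinate subspace of \<open>G\<close> and fixes
  the coordinates in \<open>G\<close> one after another at their values in the point, 1 on
  \<open>F\<close> and 0 off \<open>F\<close>. Each inclusion is strict because of
  \<open>var (g ! i)\<close> minus its value.\<close>

lemma quot_height_face_point:
  fixes \<Delta> :: "'v::finite set set"
  assumes G: "G \<in> \<Delta>" "F \<subseteq> G"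
  shows "enat (card G) \<le> quot_height (face_ideal \<Delta> {} :: ('v, 'k::field) mpoly set) (face_point F)"
proof -
  obtain g where g: "set g = G" "distinct g" using finite_distinct_list[of G] by auto
  define P :: "nat \<Rightarrow> ('v, 'k) mpoly set"
    where "P i = {p. specialise (F \<inter> set (take i g)) (G - set (take i g)) p = 0}" for i
  have "P i \<subset> P (Suc i)" if i: "i < card G" for i
  proof -
    have len: "i < length g" using i g distinct_card[of g] by simp
    then have tk: "set (take (Suc i) g) = insert (g ! i) (set (take i g))"
      by (simp add: take_Suc_conv_app_nth)
    have nin: "g ! i \<notin> set (take i g)"
      using len g(2) by (auto simp: set_conv_nth nth_eq_iff_index_eq)
    have gG: "g ! i \<in> G" using len g(1) by auto
    have "p \<in> P (Suc i)" if "p \<in> P i" for p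
    proof -
      have "specialise (F \<inter> set (take (Suc i) g)) (G - set (take (Suc i) g))
          (specialise (F \<inter> set (take i g)) (G - set (take i g)) p) = 0"
        using that unfolding P_def by (simp add: specialise_hom)
      moreover have "specialise (F \<inter> set (take (Suc i) g)) (G - set (take (Suc i) g))
          (specialise (F \<inter> set (take i g)) (G - set (take i g)) p) =
          specialise (F \<inter> set (take (Suc i) g)) (G - set (take (Suc i) g)) p"
        unfolding specialise_specialise by (rule specialise_cong) (use G tk nin in auto)
      ultimately show ?thesis unfolding P_def by simp
    qed
    moreover have "var (g ! i) - (if g ! i \<in> F then 1 else 0) \<in> P (Suc i)"
      unfolding P_def tk by (simp add: specialise_hom specialise_var)
    moreover have "var (g ! i) - (if g ! i \<in> F then 1 else 0) \<notin> P i"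
      unfolding P_def using nin gG by (simp add: specialise_hom specialise_var var_neq_0 var_neq_1)
    ultimately show ?thesis by blast
  qed
  moreover have "is_prime_ideal (P i)" for i
    unfolding P_def by (rule is_prime_ideal_kernel_specialise)
  moreover have "face_ideal \<Delta> {} \<subseteq> P i" for i
  proof
    fix p :: "('v, 'k) mpoly" assume "p \<in> face_ideal \<Delta> {}"
    then show "p \<in> P i"
      unfolding P_def using G(2) by (auto intro!: specialise_subset_zero[OF _ G(1)])
  qed
  moreover have "P (card G) \<subseteq> face_point F"
  proof -
    have "length g = card G" using g distinct_card by metis
    then have "take (card G) g = g" by simp
    moreover have "F \<inter> G = F" using G(2) by blast
    ultimately have "P (card G) = face_point F" unfolding P_def face_point_def by (simp add: g(1))
    then show ?thesis by simp
  qed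
  ultimately have "\<exists>P. (\<forall>i\<le>card G. is_prime_ideal (P i) \<and> (face_ideal \<Delta> {} ::
      ('v, 'k) mpoly set) \<subseteq> P i) \<and>
      (\<forall>i<card G. P i \<subset> P (Suc i)) \<and> P (card G) \<subseteq> face_point F"
    by (intro exI[of _ P]) blast
  then show ?thesis
    unfolding quot_height_def by (intro SUP_upper CollectI)
qed

text \<open>The grade is a supremum, possibly infinite, but a single degree k only asks for one
  regular sequence longer than k.\<close>

lemma grade_kvanish:
  assumes "enat n \<le> quot_grade J M" "is_ideal J" "k < n"
  shows "kvanish M J k"
proof -
  have "\<exists>xs. set xs \<subseteq> M \<and> quot_regular_seq J xs \<and> k < length xs"
  proof (rule ccontr)
    assume "\<not> ?thesis"
    then have "quot_grade J M \<le> enat k"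
      unfolding quot_grade_def by (intro SUP_least) (auto simp: not_less)
    then have "enat n \<le> enat k" using assms(1) by (rule order_trans[rotated])
    then show False using assms(3) by simp
  qed
  then show ?thesis using regular_seq_kvanish assms(2) by blast
qed

text \<open>Grade equals height, which is at least \<open>card G\<close>; passing to the link costs
  one degree for each vertex of \<open>F\<close>, hence the bound on
  \<open>k + card F\<close>.\<close>

lemma cohen_macaulay_kvanish:
  fixes \<Delta> :: "'v::finite set set"
  assumes cm: "cohen_macaulay_over TYPE('k::field) \<Delta>"
    and down: "\<And>F G. F \<in> \<Delta> \<Longrightarrow> G \<subseteq> F \<Longrightarrow> G \<in> \<Delta>"
    and G: "G \<in> \<Delta>" "F \<subseteq> G" and k: "k + card F < card G"
  shows "kvanish (face_point F) (face_ideal \<Delta> F :: ('v, 'k) mpoly set) k"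
proof -
  let ?M = "face_point F :: ('v, 'k) mpoly set"
  let ?I = "face_ideal \<Delta> {} :: ('v, 'k) mpoly set"
  have "?I \<subseteq> ?M"
    unfolding face_point_def using specialise_subset_zero[OF _ G(1)] G(2) by auto
  moreover have "stanley_reisner_ideal \<Delta> = ?I"
    by (rule stanley_reisner_ideal_eq) (rule down)
  then have "quot_cohen_macaulay ?I"
    using cm unfolding cohen_macaulay_over_def by simp
  ultimately have "quot_grade ?I ?M = quot_height ?I ?M"
    using is_maximal_ideal_face_point unfolding quot_cohen_macaulay_def by blast
  then have ge: "enat (card G) \<le> quot_grade ?I ?M"
    using quot_height_face_point[OF G] by simp
  \<comment> \<open>The maximal ideal stays \<open>face_point F\<close> while \<open>F'\<close>
    grows. The degree must be arbitrary, since each new vertex calls the hypothesis in degrees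
    \<open>k\<close> and \<open>Suc k\<close>.\<close>
  have "F' \<subseteq> F \<Longrightarrow> k + card F' < card G \<Longrightarrow> kvanish ?M (face_ideal \<Delta> F') k" for F' k
  proof (induction F' arbitrary: k rule: infinite_finite_induct)
    case (infinite A)
    then show ?case by simp
  next
    case empty
    then show ?case using grade_kvanish[OF ge is_ideal_face_ideal] by simp
  next
    case (insert v F')
    have "kvanish ?M (add_gen (face_ideal \<Delta> F') (var v - 1)) k"
    proof (rule kvanish_quotient[OF is_ideal_face_ideal])
      show "y \<in> face_ideal \<Delta> F'" if "(var v - 1) * y \<in> face_ideal \<Delta> F'" for y
        using face_ideal_regular insert.hyps(2) that by blast
      show "kvanish ?M (face_ideal \<Delta> F') k" "kvanish ?M (face_ideal \<Delta> F') (Suc k)"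
        using insert by auto
    qed
    then show ?case using face_ideal_insert[OF insert.hyps(2)] by metis
  qed
  then show ?thesis using k by blast
qed

text \<open>If the link of \<open>F\<close> splits into \<open>A\<close> and \<open>B\<close>, multiplication by the idempotent that is 1
  on \<open>A\<close> and 0 on \<open>B\<close> is a cocycle of degree 1 that is not a coboundary.\<close>

lemma cohen_macaulay_link_connected:
  fixes \<Delta> :: "'v::finite set set"
  assumes cm: "cohen_macaulay_over TYPE('k::field) \<Delta>"
    and down: "\<And>F G. F \<in> \<Delta> \<Longrightarrow> G \<subseteq> F \<Longrightarrow> G \<in> \<Delta>"
    and AB: "A \<inter> B = {}"
    and a: "a \<in> A - F" "insert a F \<in> \<Delta>" and b: "b \<in> B - F" "insert b F \<in> \<Delta>"
    and cover: "\<And>G. G \<in> \<Delta> \<Longrightarrow> F \<subseteq> G \<Longrightarrow> G \<subseteq> F \<union> A \<or> G \<subseteq> F \<union> B"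
    and G: "G \<in> \<Delta>" "F \<subseteq> G"
  shows "card G \<le> Suc (card F)"
proof (rule ccontr)
  assume "\<not> ?thesis"
  then have van: "kvanish (face_point F) (face_ideal \<Delta> F :: ('v, 'k) mpoly set) 1"
    using cohen_macaulay_kvanish[OF cm down G] by simp
  \<comment> \<open>On faces inside \<open>F \<union> A\<close> the value agrees with the list entry
    r; on faces inside \<open>F \<union> B\<close> it is the value of r at the point, which is zero
    for r in \<open>face_point F\<close>.\<close>
  define f :: "('v, 'k) mpoly list \<Rightarrow> ('v, 'k) mpoly" where "f as = specialise F A (hd as)" for as
  have "kcocycle (face_point F) (face_ideal \<Delta> F) 1 f"
    unfolding kcocycle_def
  proof (intro allI impI)
    fix as :: "('v, 'k) mpoly list" assume "length as = Suc 1 \<and> set as \<subseteq> face_point F"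
    then obtain p q where as: "as = [p, q]" and pq: "specialise F {} p = 0" "specialise F {} q = 0"
      by (auto simp: length_Suc_conv face_point_def)
    have "specialise F H (kdiff f as) = 0" if H: "H \<in> \<Delta>" "F \<subseteq> H" for H
    proof -
      have *: "specialise F H (specialise F A r) = specialise F (A \<inter> H) r" for r :: "('v, 'k) mpoly"
        unfolding specialise_specialise by (rule specialise_cong) auto
      show ?thesis
      proof (cases "H \<subseteq> F \<union> A")
        case True
        have "specialise F (A \<inter> H) r = specialise F H r" for r :: "('v, 'k) mpoly"
          by (rule specialise_cong) (use True in auto)
        then show ?thesis by (simp add: as f_def specialise_hom * mult.commute)
      next
        case False
        then have "H \<subseteq> F \<union> B" using cover H by blast
        then have "specialise F (A \<inter> H) r = specialise F {} r" for r :: "('v, 'k) mpoly"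
          by (intro specialise_cong) (use AB in auto)
        then show ?thesis by (simp add: as f_def specialise_hom * pq)
      qed
    qed
    then show "kdiff f as \<in> face_ideal \<Delta> F" unfolding face_ideal_def by simp
  qed
  then have "kcobound (face_point F) (face_ideal \<Delta> F) 1 f"
    using van unfolding kvanish_def by blast
  then obtain g where "\<And>as. length as = 1 \<Longrightarrow> set as \<subseteq> face_point F \<Longrightarrow> f as - kdiff g as
      \<in> face_ideal \<Delta> F"
    unfolding kcobound_def by blast
  from this[of "[p]" for p] have g: "specialise F A p - p * g [] \<in> face_ideal \<Delta> F" if "p
      \<in> face_point F" for p
    using that by (simp add: f_def)
  \<comment> \<open>The coboundary is tested on \<open>var v\<close>, which vanishes at the point of
    \<open>F\<close>, and restricted to the line through that point in direction
    \<open>v\<close>.\<close>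
  have val: "specialise F {v} (specialise F A (var v)) = var v * specialise F {v} (g [])"
    if v: "insert v F \<in> \<Delta>" "v \<notin> F" for v
  proof -
    have "var v \<in> face_point F" using v by (simp add: face_point_def specialise_var)
    then have "specialise F (insert v F) (specialise F A (var v) - var v * g []) = 0"
      using g v unfolding face_ideal_def by blast
    moreover have "specialise F (insert v F) p = specialise F {v} p" for p :: "('v, 'k) mpoly"
      by (rule specialise_cong) auto
    ultimately show ?thesis using v by (simp add: specialise_hom specialise_var)
  qed
  \<comment> \<open>All these lines meet in the point of \<open>F\<close>, so \<open>g []\<close>
    has one value there; computed along \<open>a\<close> it is 1, along \<open>b\<close> it is
    0.\<close>
  have red: "specialise F {} (specialise F {v} (g [])) = specialise F {} (g [])" for v
    unfolding specialise_specialise by (rule specialise_cong) auto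
  have "var a * (specialise F {a} (g []) - 1) = 0"
    using val[of a] a by (simp add: specialise_var algebra_simps)
  then have "specialise F {a} (g []) = 1"
    using mpoly_no_zero_divisors[of "var a" "specialise F {a} (g []) - 1"] by (simp add: var_neq_0)
  then have "specialise F {} (g []) = 1" using red[of a] by (simp add: specialise_hom)
  moreover have "var b * specialise F {b} (g []) = 0"
    using val[of b] b AB by (auto simp: specialise_var specialise_hom split: if_splits)
  then have "specialise F {b} (g []) = 0"
    using mpoly_no_zero_divisors[of "var b" "specialise F {b} (g [])"] by (simp add: var_neq_0)
  then have "specialise F {} (g []) = 0" using red[of b] by (simp add: specialise_hom)
  ultimately show False by simp
qed

section \<open>Bipartite graphs without large complete bipartite links\<close>

definition nbh :: "('v \<Rightarrow> 'v \<Rightarrow> bool) \<Rightarrow> 'v set \<Rightarrow> 'v set" where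
  "nbh E F = {w. \<exists>v\<in>F. E v w}"

text \<open>The ambient set \<open>U\<close> is a parameter because the condition has to be
  inherited by the smaller sets \<open>U - F - nbh E F\<close>, on which the induction runs.\<close>

definition link_rigid :: "('v \<Rightarrow> 'v \<Rightarrow> bool) \<Rightarrow> 'v set \<Rightarrow> 'v set \<Rightarrow> bool" where
  "link_rigid E A U \<longleftrightarrow> (\<forall>F R. F \<subseteq> U \<and> independent E F \<and> R = U - F - nbh E F \<and>
     (\<forall>x\<in>R \<inter> A. \<forall>y\<in>R - A. E x y) \<and> R \<inter> A \<noteq> {} \<and> R - A \<noteq> {} \<longrightarrow>
     card (R \<inter> A) = 1 \<and> card (R - A) = 1)"

lemma link_rigidD:
  assumes "link_rigid E A U" "F \<subseteq> U" "independent E F" "R = U - F - nbh E F"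
    "\<And>x y. x \<in> R \<inter> A \<Longrightarrow> y \<in> R - A \<Longrightarrow> E x y" "R \<inter> A \<noteq> {}" "R - A \<noteq> {}"
  shows "card (R \<inter> A) = 1 \<and> card (R - A) = 1"
proof -
  have "\<forall>x\<in>R \<inter> A. \<forall>y\<in>R - A. E x y" using assms(5) by blast
  with assms(2-4,6,7) show ?thesis
    using assms(1)[unfolded link_rigid_def, THEN spec[of _ F], THEN spec[of _ R]] by blast
qed

lemma link_rigid_link:
  assumes "link_rigid E A U" "F \<subseteq> U" "independent E F" and sym: "\<And>u v. E u v \<Longrightarrow> E v u"
  shows "link_rigid E A (U - F - nbh E F)"
  unfolding link_rigid_def
proof (intro allI impI)
  fix G R
  assume *: "G \<subseteq> U - F - nbh E F \<and> independent E G \<and> R = U - F - nbh E F - G - nbh E G \<and>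
    (\<forall>x\<in>R \<inter> A. \<forall>y\<in>R - A. E x y) \<and> R \<inter> A \<noteq> {} \<and> R - A \<noteq> {}"
  then have G: "G \<subseteq> U - F - nbh E F" "independent E G" "R = U - F - nbh E F - G - nbh E G"
    by blast+
  have "\<not> E u v" if "u \<in> F \<union> G" "v \<in> F \<union> G" for u v
    using that G(1,2) assms(3) sym[of u v] unfolding independent_def nbh_def by blast
  then have ind: "independent E (F \<union> G)" unfolding independent_def by blast
  have R: "R = U - (F \<union> G) - nbh E (F \<union> G)" using G(3) unfolding nbh_def by auto
  have "F \<union> G \<subseteq> U" using G(1) assms(2) by blast
  from link_rigidD[OF assms(1) this ind R] show "card (R \<inter> A) = 1 \<and> card (R - A) = 1"
    using * by blast
qed

text \<open>Isolated vertices are left out: they are cone points of the independence complex and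
  have no partner in a matching.\<close>

definition edge_ends :: "('v \<Rightarrow> 'v \<Rightarrow> bool) \<Rightarrow> 'v set \<Rightarrow> 'v set \<Rightarrow> 'v set" where
  "edge_ends E U S = {x \<in> U \<inter> S. \<exists>y\<in>U. E x y}"

definition matching_order :: "('v \<Rightarrow> 'v \<Rightarrow> bool) \<Rightarrow> 'v set \<Rightarrow> 'v set \<Rightarrow> ('v \<Rightarrow> 'v) \<Rightarrow> bool" where
  "matching_order E X Y \<sigma> \<longleftrightarrow> bij_betw \<sigma> X Y \<and> (\<forall>x\<in>X. E x (\<sigma> x)) \<and>
     (\<forall>x\<in>X. \<forall>y\<in>X. E x (\<sigma> y) \<longrightarrow> E y (\<sigma> x) \<longrightarrow> x = y) \<and>
     (\<forall>x\<in>X. \<forall>y\<in>X. \<forall>z\<in>X. E x (\<sigma> y) \<longrightarrow> E y (\<sigma> z) \<longrightarrow> E x (\<sigma> z))"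

text \<open>The last property of the leaf y says that every other non-isolated vertex of its side
  keeps a neighbour when x is removed, so deleting the pair isolates nothing there.\<close>

lemma link_rigid_leaf:
  assumes rigid: "link_rigid E A U" and fin: "finite U"
    and sym: "\<And>u v. E u v \<Longrightarrow> E v u" and bip: "\<And>u v. E u v \<Longrightarrow> u \<in> A \<longleftrightarrow> v \<notin> A"
    and ne: "edge_ends E U (- A) \<noteq> {}"
  obtains x y where "x \<in> U" "y \<in> U" "E x y" "x \<in> A"
    "\<And>z. z \<in> U \<Longrightarrow> E z y \<Longrightarrow> z = x"
    "\<And>w. w \<in> edge_ends E U (- A) \<Longrightarrow> w \<noteq> y \<Longrightarrow> \<exists>z\<in>U. E w z \<and> z \<noteq> x"
proof -
  define nb where "nb y = {x \<in> U. E y x}" for y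
  have fin_nb: "finite (nb y)" for y using fin by (simp add: nb_def)
  \<comment> \<open>With least cardinality, an inclusion \<open>nb w \<subseteq> nb y\<close>
    between finite sets is an equality.\<close>
  obtain y where y: "y \<in> edge_ends E U (- A)"
    and min: "\<And>w. w \<in> edge_ends E U (- A) \<Longrightarrow> card (nb y) \<le> card (nb w)"
    using ex_has_least_nat[of "\<lambda>y. y \<in> edge_ends E U (- A)" _ "\<lambda>y. card (nb y)"] ne by blast
  have nbA: "nb w \<subseteq> A" if "w \<notin> A" for w using bip that unfolding nb_def by blast
  have yA: "y \<in> U" "y \<notin> A" using y unfolding edge_ends_def by auto
  \<comment> \<open>Chosen so that what remains is \<open>nb y\<close> on one side and, on the
    other, the non-isolated w with \<open>nb w \<subseteq> nb y\<close>. By minimality these form a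
    complete bipartite graph, to which rigidity applies.\<close>
  define F where "F = (U \<inter> A - nb y) \<union> (U - A - edge_ends E U (- A))"
  define R where "R = U - F - nbh E F"
  have "independent E F"
    unfolding independent_def
  proof (intro ballI notI)
    fix u v assume "u \<in> F" "v \<in> F" "E u v"
    moreover from \<open>E u v\<close> have "E v u" "u \<in> A \<longleftrightarrow> v \<notin> A" using sym bip by blast+
    ultimately show False unfolding F_def edge_ends_def by blast
  qed
  have F: "F \<subseteq> U" unfolding F_def by blast
  have RA: "R \<inter> A = nb y"
  proof
    show "R \<inter> A \<subseteq> nb y" unfolding R_def F_def by blast
    show "nb y \<subseteq> R \<inter> A"
    proof
      fix x assume x: "x \<in> nb y"
      then have "x \<in> A" "x \<in> U" using nbA yA by (auto simp: nb_def)
      moreover have "x \<notin> nbh E F"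
      proof
        assume "x \<in> nbh E F"
        then obtain v where "v \<in> F" "E v x" unfolding nbh_def by blast
        then show False using \<open>x \<in> A\<close> \<open>x \<in> U\<close> bip unfolding F_def edge_ends_def by blast
      qed
      ultimately show "x \<in> R \<inter> A" using x unfolding R_def F_def by blast
    qed
  qed
  have RnA: "R - A = {w \<in> edge_ends E U (- A). nb w \<subseteq> nb y}"
  proof
    show "R - A \<subseteq> {w \<in> edge_ends E U (- A). nb w \<subseteq> nb y}"
    proof
      fix w assume w: "w \<in> R - A"
      then have we: "w \<in> edge_ends E U (- A)" unfolding R_def F_def by blast
      have "nb w \<subseteq> nb y"
      proof
        fix x assume x: "x \<in> nb w"
        then have "E x w" "x \<in> U \<inter> A" using sym nbA w by (auto simp: nb_def)
        then show "x \<in> nb y" using w unfolding R_def F_def nbh_def by blast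
      qed
      with we show "w \<in> {w \<in> edge_ends E U (- A). nb w \<subseteq> nb y}" by simp
    qed
    show "{w \<in> edge_ends E U (- A). nb w \<subseteq> nb y} \<subseteq> R - A"
    proof
      fix w assume w: "w \<in> {w \<in> edge_ends E U (- A). nb w \<subseteq> nb y}"
      then have wU: "w \<in> U" "w \<notin> A" unfolding edge_ends_def by auto
      have "w \<notin> nbh E F"
      proof
        assume "w \<in> nbh E F"
        then obtain v where v: "v \<in> F" "E v w" unfolding nbh_def by blast
        then have "v \<in> nb w" using sym F unfolding nb_def by blast
        then have "v \<in> nb y" "v \<in> A" using w nbA wU by blast+
        then show False using v unfolding F_def by blast
      qed
      then show "w \<in> R - A" using w wU unfolding R_def F_def by blast
    qed
  qed
  have complete: "E x w" if "x \<in> R \<inter> A" "w \<in> R - A" for x w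
  proof -
    have w: "w \<in> edge_ends E U (- A)" "nb w \<subseteq> nb y" using that(2) RnA by auto
    then have "nb w = nb y" using card_seteq[OF fin_nb] min by blast
    then show ?thesis using that(1) sym unfolding RA nb_def by blast
  qed
  have "nb y \<noteq> {}" using y unfolding edge_ends_def nb_def by blast
  then have ne': "R \<inter> A \<noteq> {}" "R - A \<noteq> {}" using y unfolding RA RnA by blast+
  have "card (R \<inter> A) = 1" "card (R - A) = 1"
    using link_rigidD[OF rigid F \<open>independent E F\<close> R_def complete ne'] by blast+
  then obtain x z where x: "nb y = {x}" and z: "R - A = {z}"
    using RA by (auto simp: card_1_singleton_iff)
  have "y \<in> R - A" using y RnA by blast
  then have z: "R - A = {y}" using z by (metis singletonD)
  show ?thesis
  proof
    have "x \<in> nb y" using x by blast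
    then show "x \<in> U" "E x y" "x \<in> A" using sym nbA yA unfolding nb_def by blast+
    show "y \<in> U" by (rule yA)
    show "z = x" if "z \<in> U" "E z y" for z
    proof -
      have "z \<in> nb y" using that sym unfolding nb_def by blast
      then show ?thesis using x by blast
    qed
    show "\<exists>z\<in>U. E w z \<and> z \<noteq> x" if "w \<in> edge_ends E U (- A)" "w \<noteq> y" for w
    proof -
      have "\<not> nb w \<subseteq> nb y" using that z RnA by blast
      then show ?thesis using x unfolding nb_def by blast
    qed
  qed
qed

text \<open>Two links are used. That of the leaf \<open>y0\<close> is \<open>U\<close> without
  \<open>x0\<close> and \<open>y0\<close> and supplies the matching to be extended; that of
  \<open>x0\<close> supplies the equality of two cardinalities, from which transitivity above
  \<open>x0\<close> follows.\<close>

lemma link_rigid_matching_order: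
  assumes "link_rigid E A U" and "finite U"
    and sym: "\<And>u v. E u v \<Longrightarrow> E v u" and bip: "\<And>u v. E u v \<Longrightarrow> u \<in> A \<longleftrightarrow> v \<notin> A"
  shows "\<exists>\<sigma>. matching_order E (edge_ends E U A) (edge_ends E U (- A)) \<sigma>"
  using assms(1,2)
proof (induction "card U" arbitrary: U rule: less_induct)
  case less
  let ?X = "edge_ends E U A" and ?Y = "edge_ends E U (- A)"
  show ?case
  proof (cases "?Y = {}")
    case True
    then have "?X = {}" using sym bip unfolding edge_ends_def by blast
    with True have "matching_order E ?X ?Y id" by (simp add: matching_order_def bij_betw_def)
    then show ?thesis by blast
  next
    case False
    obtain x0 y0 where xy: "x0 \<in> U" "y0 \<in> U" "E x0 y0" "x0 \<in> A"
      and leaf: "\<And>z. z \<in> U \<Longrightarrow> E z y0 \<Longrightarrow> z = x0"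
      and other: "\<And>w. w \<in> ?Y \<Longrightarrow> w \<noteq> y0 \<Longrightarrow> \<exists>z\<in>U. E w z \<and> z \<noteq> x0"
      by (rule link_rigid_leaf[OF less.prems _ _ False])
        (rule sym, assumption, rule bip, assumption, rule that)
    have irr: "\<not> E u u" for u using bip by blast
    have y0A: "y0 \<notin> A" using bip xy by blast
    have link: "link_rigid E A (U - {v} - nbh E {v})" if "v \<in> U" for v
      by (rule link_rigid_link[OF less.prems(1)]) (use that sym irr in \<open>auto simp: independent_def\<close>)
    define U1 where "U1 = U - {y0} - nbh E {y0}"
    define U2 where "U2 = U - {x0} - nbh E {x0}"
    have U1: "U1 = U - {x0, y0}" using leaf xy sym unfolding U1_def nbh_def by blast
    have sub: "card U1 < card U" "card U2 < card U"
      using xy less.prems(2) unfolding U1 U2_def by (auto intro!: psubset_card_mono)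
    have fin: "finite U1" "finite U2" using less.prems(2) unfolding U1 U2_def by auto
    obtain \<tau> where \<tau>: "matching_order E (edge_ends E U1 A) (edge_ends E U1 (- A)) \<tau>"
      using less.hyps[OF sub(1) _ fin(1)] link[of y0] xy unfolding U1_def by auto
    obtain \<rho> where \<rho>: "matching_order E (edge_ends E U2 A) (edge_ends E U2 (- A)) \<rho>"
      using less.hyps[OF sub(2) _ fin(2)] link[of x0] xy unfolding U2_def by auto
    have X1: "edge_ends E U1 A = ?X - {x0}"
    proof
      show "edge_ends E U1 A \<subseteq> ?X - {x0}" unfolding U1 edge_ends_def by blast
      show "?X - {x0} \<subseteq> edge_ends E U1 A"
      proof
        fix x assume x: "x \<in> ?X - {x0}"
        then obtain y where y: "y \<in> U" "E x y" unfolding edge_ends_def by blast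
        have "x \<in> A" "x \<in> U" using x unfolding edge_ends_def by auto
        then have "y \<noteq> y0" "y \<noteq> x0" "x \<noteq> y0" using leaf x y bip xy y0A by blast+
        then show "x \<in> edge_ends E U1 A"
          using x y \<open>x \<in> A\<close> \<open>x \<in> U\<close> unfolding edge_ends_def U1 by blast
      qed
    qed
    \<comment> \<open>Here the last property of the leaf enters; on the side of \<open>A\<close> it
      was enough that \<open>x0\<close> alone is adjacent to \<open>y0\<close>.\<close>
    have Y1: "edge_ends E U1 (- A) = ?Y - {y0}"
    proof
      show "edge_ends E U1 (- A) \<subseteq> ?Y - {y0}" unfolding U1 edge_ends_def by blast
      show "?Y - {y0} \<subseteq> edge_ends E U1 (- A)"
      proof
        fix y assume y: "y \<in> ?Y - {y0}"
        then obtain x where x: "x \<in> U" "E y x" "x \<noteq> x0" using other by blast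
        have "y \<notin> A" "y \<in> U" using y unfolding edge_ends_def by auto
        then have "x \<noteq> y0" "y \<noteq> x0" using x bip xy y0A by blast+
        then show "y \<in> edge_ends E U1 (- A)"
          using y x \<open>y \<notin> A\<close> \<open>y \<in> U\<close> unfolding edge_ends_def U1 by blast
      qed
    qed
    have x0X: "x0 \<in> ?X" and y0Y: "y0 \<in> ?Y" using xy y0A sym unfolding edge_ends_def by blast+
    define \<sigma> where "\<sigma> = \<tau>(x0 := y0)"
    have bij\<tau>: "bij_betw \<tau> (?X - {x0}) (?Y - {y0})"
      and m\<tau>: "\<And>x. x \<in> ?X - {x0} \<Longrightarrow> E x (\<tau> x)"
      and anti\<tau>: "\<And>x y. x \<in> ?X - {x0} \<Longrightarrow> y \<in> ?X - {x0} \<Longrightarrow> E x (\<tau> y) \<Longrightarrow> E y (\<tau> x) \<Longrightarrow> x = y"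
      and trans\<tau>: "\<And>x y z. x \<in> ?X - {x0} \<Longrightarrow> y \<in> ?X - {x0} \<Longrightarrow> z \<in> ?X - {x0} \<Longrightarrow>
        E x (\<tau> y) \<Longrightarrow> E y (\<tau> z) \<Longrightarrow> E x (\<tau> z)"
      using \<tau> unfolding matching_order_def X1 Y1 by blast+
    have "bij_betw \<sigma> (?X - {x0}) (?Y - {y0})"
      using bij\<tau> by (subst bij_betw_cong[of _ _ \<tau>]) (auto simp: \<sigma>_def)
    moreover have "bij_betw \<sigma> {x0} {y0}" by (simp add: bij_betw_def \<sigma>_def)
    ultimately have "bij_betw \<sigma> (?X - {x0} \<union> {x0}) (?Y - {y0} \<union> {y0})"
      by (rule bij_betw_combine) blast
    moreover have "?X - {x0} \<union> {x0} = ?X" "?Y - {y0} \<union> {y0} = ?Y" using x0X y0Y by auto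
    ultimately have bij: "bij_betw \<sigma> ?X ?Y" by simp
    have m: "E x (\<sigma> x)" if "x \<in> ?X" for x using m\<tau> that xy by (auto simp: \<sigma>_def)
    have XU: "x \<in> U" if "x \<in> ?X" for x using that unfolding edge_ends_def by blast
    \<comment> \<open>\<open>x0\<close> is minimal, so a chain that passes through \<open>x0\<close>
      begins there.\<close>
    have low: "x = x0" if "x \<in> ?X" "E x (\<sigma> x0)" for x
      using leaf that XU by (auto simp: \<sigma>_def)
    have \<sigma>\<tau>: "\<sigma> x = \<tau> x" if "x \<noteq> x0" for x using that by (simp add: \<sigma>_def)
    have anti: "x = y" if "x \<in> ?X" "y \<in> ?X" "E x (\<sigma> y)" "E y (\<sigma> x)" for x y
      using that low anti\<tau> \<sigma>\<tau> by (metis Diff_iff singletonD)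
    txt \<open>Transitivity at the new minimal element: the link of \<^term>\<open>x0\<close> has equally many
      non-isolated vertices on both sides, so every vertex below one of its
      matched pairs is itself matched inside the link.\<close>
    have new: "E x0 (\<sigma> z)" if y: "y \<in> ?X" and z: "z \<in> ?X" and e: "E x0 (\<sigma> y)" "E y (\<sigma> z)" for y z
    proof (rule ccontr)
      assume nz: "\<not> E x0 (\<sigma> z)"
      \<comment> \<open>The matched pairs that survive whole in the link of
        \<open>x0\<close>.\<close>
      define K where "K = {x \<in> ?X. \<not> E x0 (\<sigma> x)}"
      have img: "\<sigma> x \<in> ?Y" if "x \<in> ?X" for x using bij that by (auto simp: bij_betw_def)
      have inU2: "x \<in> U2" if "x \<in> ?X" "x \<noteq> x0" for x
        using that xy bip unfolding U2_def nbh_def edge_ends_def by blast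
      have inU2': "\<sigma> x \<in> U2" if "x \<in> ?X" "\<not> E x0 (\<sigma> x)" for x
        using that img[OF that(1)] xy unfolding U2_def nbh_def edge_ends_def by blast
      have K2: "K \<subseteq> edge_ends E U2 A"
      proof
        fix x assume x: "x \<in> K"
        then have "x \<noteq> x0" "x \<in> ?X" "\<not> E x0 (\<sigma> x)" using m unfolding K_def by auto
        then show "x \<in> edge_ends E U2 A"
          using inU2 inU2' m unfolding edge_ends_def by blast
      qed
      have "edge_ends E U2 (- A) \<subseteq> \<sigma> ` K"
      proof
        fix w assume w: "w \<in> edge_ends E U2 (- A)"
        then have "w \<in> ?Y" "\<not> E x0 w" unfolding edge_ends_def U2_def nbh_def by blast+
        then obtain x where "x \<in> ?X" "w = \<sigma> x" using bij unfolding bij_betw_def by blast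
        then show "w \<in> \<sigma> ` K" using \<open>\<not> E x0 w\<close> unfolding K_def by blast
      qed
      moreover have "finite K" using less.prems(2) unfolding K_def edge_ends_def by simp
      ultimately have "card (edge_ends E U2 (- A)) \<le> card K"
        by (meson card_image_le card_mono finite_imageI order_trans)
      moreover have "card (edge_ends E U2 A) = card (edge_ends E U2 (- A))"
        using \<rho> bij_betw_same_card unfolding matching_order_def by blast
      moreover have "finite (edge_ends E U2 A)" using fin(2) unfolding edge_ends_def by simp
      ultimately have "K = edge_ends E U2 A" using card_seteq K2 by metis
      \<comment> \<open>In the link \<open>y\<close> is not isolated, because of \<sigma> z, yet its
        partner \<sigma> y was deleted as a neighbour of \<open>x0\<close>; so \<open>y\<close> is
        outside \<open>K\<close>.\<close>
      moreover have "y \<noteq> x0" using nz e by blast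
      then have "y \<in> edge_ends E U2 A"
        using inU2[OF y] inU2'[OF z nz] e(2) y unfolding edge_ends_def by blast
      ultimately show False using e(1) unfolding K_def by blast
    qed
    have trans: "E x (\<sigma> z)"
      if "x \<in> ?X" "y \<in> ?X" "z \<in> ?X" "E x (\<sigma> y)" "E y (\<sigma> z)" for x y z
    proof (cases "x = x0 \<or> y = x0 \<or> z = x0")
      case True
      then show ?thesis using that new low by blast
    next
      case False
      then show ?thesis using that trans\<tau>[of x y z] \<sigma>\<tau> by auto
    qed
    have "matching_order E ?X ?Y \<sigma>"
      unfolding matching_order_def using bij m anti trans by blast
    then show ?thesis by blast
  qed
qed

section \<open>Counting independent sets by antichains\<close>

text \<open>A Boolean interval from size c to size d contributes the unit vector at c to the
  h-vector: regrouping the binomials leaves the factor (1 - 1)^(j - c). The guard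
  \<open>c \<le> i\<close> offsets truncated subtraction, which would make the binomial 1 below
  c.\<close>

lemma alternating_sum_choose_mult:
  fixes c j d :: nat
  assumes "j \<le> d" "c \<le> d"
  shows "(\<Sum>i=0..j. (-1) ^ (j - i) * int ((d - i) choose (j - i)) *
      int (if c \<le> i then (d - c) choose (i - c) else 0)) = (if j = c then 1 else 0)"
proof (cases "c \<le> j")
  case False
  then show ?thesis by simp
next
  case True
  have "(\<Sum>i=0..j. (-1) ^ (j - i) * int ((d - i) choose (j - i)) *
      int (if c \<le> i then (d - c) choose (i - c) else 0)) =
      (\<Sum>i=c..j. (-1) ^ (j - i) * int ((d - i) choose (j - i)) * int ((d - c) choose (i - c)))"
    by (rule sum.mono_neutral_cong_right) auto
  also have "\<dots> = (\<Sum>k=0..j - c. (-1) ^ (j - c - k) * int ((d - c - k) choose (j - c - k)) * int ((d - c) choose k))"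
    by (rule sum.reindex_bij_witness[where i = "\<lambda>k. k + c" and j = "\<lambda>i. i - c"]) (use True in auto)
  also have "\<dots> = (\<Sum>k\<le>j - c. int ((d - c) choose (j - c)) * ((-1) ^ (j - c - k) * int ((j - c) choose k)))"
  proof (rule sum.cong)
    fix k assume "k \<in> {..j - c}"
    then have "((d - c) choose (j - c)) * ((j - c) choose k) =
        ((d - c) choose k) * ((d - c - k) choose (j - c - k))"
      using assms by (intro choose_mult) auto
    then show "(-1) ^ (j - c - k) * int ((d - c - k) choose (j - c - k)) * int ((d - c) choose k) =
        int ((d - c) choose (j - c)) * ((-1) ^ (j - c - k) * int ((j - c) choose k))"
      by (simp add: mult.left_commute mult.commute flip: of_nat_mult)
  qed auto
  also have "\<dots> = int ((d - c) choose (j - c)) *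
      (\<Sum>k\<le>j - c. int ((j - c) choose k) * 1 ^ k * (-1) ^ (j - c - k))"
    by (simp add: sum_distrib_left mult.commute)
  also have "(\<Sum>k\<le>j - c. int ((j - c) choose k) * 1 ^ k * (-1) ^ (j - c - k)) = (1 + (-1)) ^ (j - c)"
    by (rule binomial_ring[symmetric])
  also have "int ((d - c) choose (j - c)) * (1 + (-1)) ^ (j - c) = (if j = c then 1 else 0)"
    using True by auto
  finally show ?thesis .
qed

text \<open>The h-vector is linear in the face numbers, so the contributions of the intervals add
  up.\<close>

lemma hvec_partition:
  assumes fin: "finite \<A>" and d: "cx_d \<Delta> = d" and le: "\<And>C. C \<in> \<A> \<Longrightarrow> card C \<le> d"
    and fc: "\<And>i. fcount \<Delta> i = (\<Sum>C\<in>\<A>. if card C \<le> i then (d - card C) choose (i - card C) else 0)"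
    and j: "j \<le> d"
  shows "hvec \<Delta> j = int (card {C \<in> \<A>. card C = j})"
proof -
  have "hvec \<Delta> j = (\<Sum>i=0..j. \<Sum>C\<in>\<A>. (-1) ^ (j - i) * int ((d - i) choose (j - i)) *
      int (if card C \<le> i then (d - card C) choose (i - card C) else 0))"
    unfolding hvec_def d fc by (simp add: sum_distrib_left)
  also have "\<dots> = (\<Sum>C\<in>\<A>. \<Sum>i=0..j. (-1) ^ (j - i) * int ((d - i) choose (j - i)) *
      int (if card C \<le> i then (d - card C) choose (i - card C) else 0))"
    by (rule sum.swap)
  also have "\<dots> = (\<Sum>C\<in>\<A>. if j = card C then 1 else 0)"
    by (intro sum.cong refl alternating_sum_choose_mult j le)
  also have "\<dots> = int (card {C \<in> \<A>. card C = j})"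
    using fin by (simp add: sum.If_cases Int_def eq_commute)
  finally show ?thesis .
qed

lemma card_subsets_shifted:
  assumes "finite C" "finite S" "C \<inter> S = {}"
  shows "card {F. C \<subseteq> F \<and> F \<subseteq> C \<union> S \<and> card F = i} =
    (if card C \<le> i then card S choose (i - card C) else 0)"
proof (cases "card C \<le> i")
  case True
  have "bij_betw (\<lambda>T. C \<union> T) {T. T \<subseteq> S \<and> card T = i - card C}
      {F. C \<subseteq> F \<and> F \<subseteq> C \<union> S \<and> card F = i}"
  proof (rule bij_betw_byWitness[where f' = "\<lambda>F. F - C"])
    show "\<forall>T\<in>{T. T \<subseteq> S \<and> card T = i - card C}. C \<union> T - C = T" using assms(3) by blast
    show "\<forall>F\<in>{F. C \<subseteq> F \<and> F \<subseteq> C \<union> S \<and> card F = i}. C \<union> (F - C) = F" by blast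
    show "(\<lambda>T. C \<union> T) ` {T. T \<subseteq> S \<and> card T = i - card C} \<subseteq> {F. C \<subseteq> F \<and> F \<subseteq> C \<union> S \<and> card F = i}"
    proof
      fix F assume "F \<in> (\<lambda>T. C \<union> T) ` {T. T \<subseteq> S \<and> card T = i - card C}"
      then obtain T where T: "T \<subseteq> S" "card T = i - card C" "F = C \<union> T" by blast
      have "C \<inter> T = {}" "finite T" using T assms finite_subset by blast+
      then have "card F = i" using T True assms by (simp add: card_Un_disjoint)
      then show "F \<in> {F. C \<subseteq> F \<and> F \<subseteq> C \<union> S \<and> card F = i}" using T by blast
    qed
    show "(\<lambda>F. F - C) ` {F. C \<subseteq> F \<and> F \<subseteq> C \<union> S \<and> card F = i} \<subseteq> {T. T \<subseteq> S \<and> card T = i - card C}"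
      using assms by (auto simp: card_Diff_subset)
  qed
  then have "card {F. C \<subseteq> F \<and> F \<subseteq> C \<union> S \<and> card F = i} = card {T. T \<subseteq> S \<and> card T = i - card C}"
    by (rule bij_betw_same_card[symmetric])
  then show ?thesis using True n_subsets[OF assms(2)] by simp
next
  case False
  have empty: "{F. C \<subseteq> F \<and> F \<subseteq> C \<union> S \<and> card F = i} = {}"
  proof (rule ccontr)
    assume "\<not> ?thesis"
    then obtain F where F: "C \<subseteq> F" "F \<subseteq> C \<union> S" "card F = i" by blast
    then have "card C \<le> card F" using assms by (meson card_mono finite_UnI finite_subset)
    then show False using F False by simp
  qed
  show ?thesis unfolding empty using False by simp
qed

text \<open>Take c below x with the fewest elements below it; an element strictly below c would have
  a smaller down-set.\<close>

lemma finite_poset_minimal_below: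
  assumes fin: "finite S" and x: "x \<in> S"
    and trans: "\<And>a b c. a \<in> S \<Longrightarrow> b \<in> S \<Longrightarrow> c \<in> S \<Longrightarrow> R a b \<Longrightarrow> R b c \<Longrightarrow> R a c"
    and anti: "\<And>a b. a \<in> S \<Longrightarrow> b \<in> S \<Longrightarrow> R a b \<Longrightarrow> R b a \<Longrightarrow> a = b"
    and refl: "\<And>a. a \<in> S \<Longrightarrow> R a a"
  shows "\<exists>c\<in>S. R c x \<and> (\<forall>y\<in>S. R y c \<longrightarrow> y = c)"
proof -
  obtain c where c: "c \<in> S \<and> R c x"
    and min: "\<And>y. y \<in> S \<and> R y x \<Longrightarrow> card {z \<in> S. R z c} \<le> card {z \<in> S. R z y}"
    using ex_has_least_nat[of "\<lambda>c. c \<in> S \<and> R c x" x "\<lambda>c. card {z \<in> S. R z c}"] x refl by blast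
  have "y = c" if y: "y \<in> S" "R y c" for y
  proof -
    have "R y x" using trans[of y c x] y c x by blast
    then have "card {z \<in> S. R z c} \<le> card {z \<in> S. R z y}" using min y by blast
    moreover have "{z \<in> S. R z y} \<subseteq> {z \<in> S. R z c}" using trans y c by blast
    ultimately have "{z \<in> S. R z y} = {z \<in> S. R z c}" using fin by (intro card_seteq) auto
    then have "R c y" using c refl by blast
    then show ?thesis using anti y c by blast
  qed
  then show ?thesis using c by blast
qed

section \<open>Independent sets of a bipartite graph with a matching order\<close>

locale matched_graph =
  fixes E :: "'v::finite \<Rightarrow> 'v \<Rightarrow> bool" and X Y :: "'v set" and \<sigma> :: "'v \<Rightarrow> 'v"
  assumes order: "matching_order E X Y \<sigma>" and disj: "X \<inter> Y = {}"
    and sym: "E u v \<Longrightarrow> E v u" and ends: "E u v \<Longrightarrow> u \<in> X \<and> v \<in> Y \<or> u \<in> Y \<and> v \<in> X"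
begin

lemma bij: "bij_betw \<sigma> X Y"
  and refl: "x \<in> X \<Longrightarrow> E x (\<sigma> x)"
  and anti: "x \<in> X \<Longrightarrow> y \<in> X \<Longrightarrow> E x (\<sigma> y) \<Longrightarrow> E y (\<sigma> x) \<Longrightarrow> x = y"
  and trans: "x \<in> X \<Longrightarrow> y \<in> X \<Longrightarrow> z \<in> X \<Longrightarrow> E x (\<sigma> y) \<Longrightarrow> E y (\<sigma> z) \<Longrightarrow> E x (\<sigma> z)"
  using order unfolding matching_order_def by blast+

definition antichains :: "'v set set" where
  "antichains = {C. C \<subseteq> X \<and> (\<forall>x\<in>C. \<forall>y\<in>C. E x (\<sigma> y) \<longrightarrow> x = y)}"

text \<open>The relation \<open>E x (\<sigma> y)\<close> is a partial order on \<open>X\<close>. An independent set \<open>F\<close> is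
  classified by the antichain \<open>C\<close> of minimal elements of \<open>F \<inter> X\<close>; those with given \<open>C\<close> form
  the interval from \<open>C\<close> to \<open>C \<union> free C\<close>.\<close>

definition up :: "'v set \<Rightarrow> 'v set" where
  "up C = {x \<in> X. \<exists>c\<in>C. E c (\<sigma> x)}"

text \<open>Each matched pair retains exactly one usable vertex: x if x is in \<open>up C\<close>,
  otherwise \<sigma> x. With the isolated vertices \<open>- X - Y\<close> added, the tops
  \<open>C \<union> free C\<close> have the same size \<open>dim\<close> for all antichains.\<close>

definition free :: "'v set \<Rightarrow> 'v set" where
  "free C = (up C - C) \<union> \<sigma> ` (X - up C) \<union> (- X - Y)"

definition dim where "dim = card X + card (- X - Y)"

lemma subset_up: "C \<in> antichains \<Longrightarrow> C \<subseteq> up C"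
  unfolding antichains_def up_def using refl by blast

lemma \<sigma>_in: "x \<in> X \<Longrightarrow> \<sigma> x \<in> Y"
  using bij unfolding bij_betw_def by blast

lemma card_free:
  assumes "C \<in> antichains"
  shows "card (free C) = dim - card C" "card C \<le> dim"
proof -
  have C: "C \<subseteq> up C" "up C \<subseteq> X" using subset_up[OF assms] unfolding up_def by blast+
  have "inj_on \<sigma> (X - up C)" using bij by (meson Diff_subset bij_betw_imp_inj_on inj_on_subset)
  then have "card (\<sigma> ` (X - up C)) = card X - card (up C)"
    using C by (simp add: card_image card_Diff_subset)
  moreover have "card (up C - C) = card (up C) - card C" using C by (simp add: card_Diff_subset)
  moreover have "\<sigma> ` (X - up C) \<subseteq> Y" using \<sigma>_in by blast
  then have "(up C - C) \<inter> \<sigma> ` (X - up C) = {}"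
    "((up C - C) \<union> \<sigma> ` (X - up C)) \<inter> (- X - Y) = {}"
    using C disj by blast+
  then have "card (free C) = card (up C - C) + card (\<sigma> ` (X - up C)) + card (- X - Y)"
    unfolding free_def by (simp add: card_Un_disjoint)
  moreover have "card C \<le> card (up C)" "card (up C) \<le> card X" using C by (auto intro: card_mono)
  ultimately show "card (free C) = dim - card C" "card C \<le> dim" unfolding dim_def by auto
qed

lemma disjoint_free: "C \<in> antichains \<Longrightarrow> C \<inter> free C = {}"
  using \<sigma>_in disj unfolding free_def antichains_def by auto

text \<open>If u in \<open>up C\<close> were adjacent to \<sigma> x with x outside
  \<open>up C\<close>, some c in \<open>C\<close> would satisfy c \<le> u \<le> x, and transitivity
  would put x into \<open>up C\<close>.\<close>

lemma interval_independent:
  assumes C: "C \<in> antichains" and F: "C \<subseteq> F" "F \<subseteq> C \<union> free C"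
  shows "independent E F"
proof -
  have no: False if uv: "u \<in> F" "v \<in> F" "E u v" "u \<in> X" "v \<in> Y" for u v
  proof -
    have "\<sigma> ` (X - up C) \<subseteq> Y" using \<sigma>_in by blast
    then have "u \<in> up C" using F uv disj subset_up[OF C] unfolding free_def by blast
    then obtain c where c: "c \<in> C" "E c (\<sigma> u)" unfolding up_def by blast
    have CX: "C \<subseteq> X" using C unfolding antichains_def by blast
    then have "v \<in> \<sigma> ` (X - up C)"
      using F uv disj unfolding free_def up_def by blast
    then obtain x where x: "x \<in> X" "x \<notin> up C" "v = \<sigma> x" by blast
    have "E c (\<sigma> x)" using trans[of c u x] c CX uv x by blast
    then show False using c x unfolding up_def by blast
  qed
  show ?thesis
    unfolding independent_def
  proof (intro ballI notI)
    fix u v assume uv: "u \<in> F" "v \<in> F" "E u v"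
    then show False using ends[OF uv(3)] no[of u v] no[of v u] sym[OF uv(3)] by blast
  qed
qed

lemma independent_in_interval:
  assumes F: "independent E F"
  shows "\<exists>C\<in>antichains. C \<subseteq> F \<and> F \<subseteq> C \<union> free C"
proof -
  define C where "C = {x \<in> F \<inter> X. \<forall>y\<in>F \<inter> X. E y (\<sigma> x) \<longrightarrow> y = x}"
  have "C \<in> antichains" unfolding antichains_def C_def by blast
  have upF: "F \<inter> X \<subseteq> up C"
  proof
    fix x assume x: "x \<in> F \<inter> X"
    have "\<exists>c\<in>F \<inter> X. E c (\<sigma> x) \<and> (\<forall>y\<in>F \<inter> X. E y (\<sigma> c) \<longrightarrow> y = c)"
      by (rule finite_poset_minimal_below[where R = "\<lambda>a b. E a (\<sigma> b)"])
        (use x in \<open>auto intro: trans anti refl\<close>)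
    then show "x \<in> up C" using x unfolding up_def C_def by blast
  qed
  have "v \<in> \<sigma> ` (X - up C)" if v: "v \<in> F" "v \<in> Y" for v
  proof -
    obtain x where x: "x \<in> X" "v = \<sigma> x" using v bij unfolding bij_betw_def by blast
    have "x \<notin> up C"
    proof
      assume "x \<in> up C"
      then obtain c where "c \<in> F" "E c v" using x unfolding up_def C_def by blast
      then show False using F v unfolding independent_def by blast
    qed
    then show ?thesis using x by blast
  qed
  then have "F \<subseteq> C \<union> free C" using upF unfolding free_def by blast
  moreover have "C \<subseteq> F" unfolding C_def by blast
  ultimately show ?thesis using \<open>C \<in> antichains\<close> by blast
qed

text \<open>This makes the intervals disjoint. Every x in \<open>F \<inter> X\<close> lies above
  some c in \<open>C\<close>, so a minimal x is that c; conversely the antichain property and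
  antisymmetry make each element of \<open>C\<close> minimal.\<close>

lemma interval_unique:
  assumes C: "C \<in> antichains" and F: "C \<subseteq> F" "F \<subseteq> C \<union> free C"
  shows "C = {x \<in> F \<inter> X. \<forall>y\<in>F \<inter> X. E y (\<sigma> x) \<longrightarrow> y = x}"
proof -
  have CX: "C \<subseteq> X" and ac: "\<And>x y. x \<in> C \<Longrightarrow> y \<in> C \<Longrightarrow> E x (\<sigma> y) \<Longrightarrow> x = y"
    using C unfolding antichains_def by blast+
  have upF: "\<exists>c\<in>C. E c (\<sigma> x)" if x: "x \<in> F \<inter> X" for x
  proof -
    have "\<sigma> ` (X - up C) \<inter> X = {}" using \<sigma>_in disj by blast
    then have "x \<in> up C" using F x subset_up[OF C] unfolding free_def by blast
    then show ?thesis unfolding up_def by blast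
  qed
  show ?thesis
  proof
    show "C \<subseteq> {x \<in> F \<inter> X. \<forall>y\<in>F \<inter> X. E y (\<sigma> x) \<longrightarrow> y = x}"
    proof
      fix x assume x: "x \<in> C"
      have "y = x" if y: "y \<in> F \<inter> X" "E y (\<sigma> x)" for y
      proof -
        obtain c where c: "c \<in> C" "E c (\<sigma> y)" using upF y by blast
        then have "E c (\<sigma> x)" using trans[of c y x] y x CX by blast
        then have "c = x" using ac c x by blast
        then show ?thesis using anti[of x y] c y x CX by blast
      qed
      then show "x \<in> {x \<in> F \<inter> X. \<forall>y\<in>F \<inter> X. E y (\<sigma> x) \<longrightarrow> y = x}" using x F CX by blast
    qed
    show "{x \<in> F \<inter> X. \<forall>y\<in>F \<inter> X. E y (\<sigma> x) \<longrightarrow> y = x} \<subseteq> C"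
    proof
      fix x assume x: "x \<in> {x \<in> F \<inter> X. \<forall>y\<in>F \<inter> X. E y (\<sigma> x) \<longrightarrow> y = x}"
      then obtain c where "c \<in> C" "E c (\<sigma> x)" using upF[of x] by blast
      then show "x \<in> C" using x F CX by blast
    qed
  qed
qed

lemma fcount_Ind:
  "fcount (Ind UNIV E) i =
    (\<Sum>C\<in>antichains. if card C \<le> i then (dim - card C) choose (i - card C) else 0)"
proof -
  let ?B = "\<lambda>C. {F. C \<subseteq> F \<and> F \<subseteq> C \<union> free C \<and> card F = i}"
  have "{F \<in> Ind UNIV E. card F = i} = (\<Union>C\<in>antichains. ?B C)"
  proof
    show "{F \<in> Ind UNIV E. card F = i} \<subseteq> (\<Union>C\<in>antichains. ?B C)"
    proof
      fix F assume "F \<in> {F \<in> Ind UNIV E. card F = i}"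
      then have "independent E F" "card F = i" unfolding Ind_def by auto
      then show "F \<in> (\<Union>C\<in>antichains. ?B C)" using independent_in_interval by blast
    qed
    show "(\<Union>C\<in>antichains. ?B C) \<subseteq> {F \<in> Ind UNIV E. card F = i}"
      unfolding Ind_def by (auto intro: interval_independent)
  qed
  then have "fcount (Ind UNIV E) i = card (\<Union>C\<in>antichains. ?B C)" unfolding fcount_def by simp
  also have "\<dots> = (\<Sum>C\<in>antichains. card (?B C))"
  proof (rule card_UN_disjoint)
    show "\<forall>C\<in>antichains. \<forall>D\<in>antichains. C \<noteq> D \<longrightarrow> ?B C \<inter> ?B D = {}"
    proof (intro ballI impI equals0I)
      fix C D F assume "C \<in> antichains" "D \<in> antichains" "C \<noteq> D" "F \<in> ?B C \<inter> ?B D"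
      then show False using interval_unique[of C F] interval_unique[of D F] by simp
    qed
  qed auto
  also have "\<dots> = (\<Sum>C\<in>antichains. if card C \<le> i then (dim - card C) choose (i - card C) else 0)"
    by (rule sum.cong) (simp_all add: card_subsets_shifted disjoint_free card_free)
  finally show ?thesis .
qed

lemma cx_d_Ind: "cx_d (Ind UNIV E) = dim"
  unfolding cx_d_def
proof (rule Max_eqI)
  show "n \<le> dim" if n: "n \<in> card ` Ind UNIV E" for n
  proof -
    obtain F where F: "independent E F" "n = card F" using n unfolding Ind_def by blast
    obtain C where C: "C \<in> antichains" "F \<subseteq> C \<union> free C" using independent_in_interval[OF F(1)]
        by blast
    have "card F \<le> card (C \<union> free C)" using C(2) by (intro card_mono) auto
    also have "\<dots> = dim" using card_free[OF C(1)] disjoint_free[OF C(1)]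
        by (simp add: card_Un_disjoint)
    finally show ?thesis using F by simp
  qed
  \<comment> \<open>The bound is attained at the top of the interval of the empty antichain, which
    is \<open>Y\<close> together with the isolated vertices.\<close>
  have "{} \<in> antichains" unfolding antichains_def by simp
  then have "independent E (free {})" "card (free {}) = dim"
    using interval_independent[of "{}" "free {}"] card_free[of "{}"] by auto
  then show "dim \<in> card ` Ind UNIV E" unfolding Ind_def
      by (auto intro!: rev_image_eqI[of "free {}"])
qed simp

lemma hvec_Ind: "j \<le> dim \<Longrightarrow> hvec (Ind UNIV E) j = int (card {C \<in> antichains. card C = j})"
  by (rule hvec_partition[OF _ cx_d_Ind _ fcount_Ind]) (auto intro: card_free)

lemma hvec_is_face_vector:
  "\<exists>(W :: nat set) H. simple_graph_on W H \<and>
     face_vector_is (Ind W H) (map (hvec (Ind UNIV E)) [0..<hvec_last (Ind UNIV E) + 1])"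
proof -
  obtain \<iota> :: "'v \<Rightarrow> nat" where \<iota>: "inj \<iota>"
    using finite_imp_inj_to_nat_seg[of "UNIV :: 'v set"] by auto
  define W where "W = \<iota> ` X"
  define H where "H a b \<longleftrightarrow> (\<exists>x\<in>X. \<exists>y\<in>X. a = \<iota> x \<and> b = \<iota> y \<and> x \<noteq> y \<and> (E x (\<sigma> y) \<or> E y (\<sigma> x)))"
    for a b
  have graph: "simple_graph_on W H"
    unfolding simple_graph_on_def W_def H_def using \<iota> by (auto simp: inj_eq)
  have Ind: "Ind W H = (\<lambda>C. \<iota> ` C) ` antichains"
  proof
    show "Ind W H \<subseteq> (\<lambda>C. \<iota> ` C) ` antichains"
    proof
      fix F assume F: "F \<in> Ind W H"
      then obtain C where C: "C \<subseteq> X" "F = \<iota> ` C" unfolding Ind_def W_def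
          by (auto simp: subset_image_iff)
      have "C \<in> antichains"
        using F C unfolding antichains_def Ind_def independent_def H_def by blast
      then show "F \<in> (\<lambda>C. \<iota> ` C) ` antichains" using C by blast
    qed
    show "(\<lambda>C. \<iota> ` C) ` antichains \<subseteq> Ind W H"
    proof
      fix F assume "F \<in> (\<lambda>C. \<iota> ` C) ` antichains"
      then obtain C where C: "C \<subseteq> X" "F = \<iota> ` C"
        and ac: "\<And>x y. x \<in> C \<Longrightarrow> y \<in> C \<Longrightarrow> E x (\<sigma> y) \<Longrightarrow> x = y"
        unfolding antichains_def by blast
      have "\<not> H (\<iota> x) (\<iota> y)" if "x \<in> C" "y \<in> C" for x y
      proof
        assume "H (\<iota> x) (\<iota> y)"
        then have "x \<noteq> y" "E x (\<sigma> y) \<or> E y (\<sigma> x)" using \<iota> unfolding H_def by (auto simp: inj_eq)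
        then show False using ac that by blast
      qed
      then show "F \<in> Ind W H" using C unfolding Ind_def independent_def W_def by blast
    qed
  qed
  have card_img: "card (\<iota> ` C) = card C" for C
    using \<iota> by (meson card_image inj_on_subset subset_UNIV)
  have fc: "fcount (Ind W H) i = card {C \<in> antichains. card C = i}" for i
  proof -
    have "{F \<in> Ind W H. card F = i} = (\<lambda>C. \<iota> ` C) ` {C \<in> antichains. card C = i}"
      unfolding Ind by (auto simp: card_img)
    moreover have "inj_on (\<lambda>C. \<iota> ` C) {C \<in> antichains. card C = i}"
      using \<iota> by (auto simp: inj_on_def inj_image_eq_iff)
    ultimately show ?thesis unfolding fcount_def by (simp add: card_image)
  qed
  \<comment> \<open>The largest size of an antichain is both the size of a largest face of
    \<open>Ind W H\<close> and the index of the last nonzero entry of the h-vector, so the truncated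
    list has the right length.\<close>
  define m where "m = cx_d (Ind W H)"
  have m: "m = Max (card ` antichains)"
    unfolding m_def cx_d_def Ind image_image card_img ..
  have "{} \<in> antichains" unfolding antichains_def by simp
  then have "m \<in> card ` antichains" unfolding m by (intro Max_in) auto
  then obtain C where C: "C \<in> antichains" "card C = m" by blast
  then have m_le: "m \<le> dim" using card_free(2) by blast
  have "hvec (Ind UNIV E) m \<noteq> 0"
    using C by (auto simp: hvec_Ind[OF m_le])
  moreover have "j \<le> m" if "j \<le> dim" "hvec (Ind UNIV E) j \<noteq> 0" for j
  proof -
    have "{C \<in> antichains. card C = j} \<noteq> {}" using that hvec_Ind by (metis card.empty of_nat_0)
    then show ?thesis unfolding m by (auto intro!: Max_ge)
  qed
  ultimately have last: "hvec_last (Ind UNIV E) = m"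
    unfolding hvec_last_def cx_d_Ind using m_le by (intro Greatest_equality) auto
  have "face_vector_is (Ind W H) (map (hvec (Ind UNIV E)) [0..<hvec_last (Ind UNIV E) + 1])"
    unfolding face_vector_is_def last using m_le
    by (auto simp: m_def[symmetric] fc hvec_Ind nth_append simp del: upt_Suc)
  with graph show ?thesis by blast
qed

end

text \<open>Completeness makes the link of F the disjoint union of two simplices, on
  \<open>R \<inter> A\<close> and \<open>R - A\<close>. It is disconnected, so a face containing F
  has at most one further vertex; F joined with a whole side of R is such a face.\<close>

lemma cohen_macaulay_bipartite_link_rigid:
  fixes E :: "'v::finite \<Rightarrow> 'v \<Rightarrow> bool"
  assumes cm: "cohen_macaulay_over TYPE('k::field) (Ind UNIV E)"
    and sym: "\<And>u v. E u v \<Longrightarrow> E v u" and bip: "\<And>u v. E u v \<Longrightarrow> u \<in> A \<longleftrightarrow> v \<notin> A"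
  shows "link_rigid E A UNIV"
  unfolding link_rigid_def
proof (intro allI impI)
  fix F R
  assume *: "F \<subseteq> UNIV \<and> independent E F \<and> R = UNIV - F - nbh E F \<and>
    (\<forall>x\<in>R \<inter> A. \<forall>y\<in>R - A. E x y) \<and> R \<inter> A \<noteq> {} \<and> R - A \<noteq> {}"
  then have F: "independent E F" and R: "R = UNIV - F - nbh E F"
    and complete: "\<And>x y. x \<in> R \<inter> A \<Longrightarrow> y \<in> R - A \<Longrightarrow> E x y" by blast+
  obtain a b where a: "a \<in> R \<inter> A" and b: "b \<in> R - A" using * by blast
  have join: "F \<union> S \<in> Ind UNIV E" if S: "S \<subseteq> R" "S \<subseteq> A \<or> S \<inter> A = {}" for S
  proof -
    have "\<not> E u v" if uv: "u \<in> F \<union> S" "v \<in> F \<union> S" for u v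
    proof
      assume e: "E u v"
      have "w \<notin> S" if "w' \<in> F" "E w' w" for w w' using that S(1) unfolding R nbh_def by blast
      then have "u \<in> F \<longrightarrow> v \<notin> S" "v \<in> F \<longrightarrow> u \<notin> S" using e sym by blast+
      moreover have "\<not> (u \<in> F \<and> v \<in> F)" using F e unfolding independent_def by blast
      moreover have "\<not> (u \<in> S \<and> v \<in> S)" using bip[OF e] S(2) by blast
      ultimately show False using uv by blast
    qed
    then show ?thesis unfolding Ind_def independent_def by blast
  qed
  have small: "card G \<le> Suc (card F)" if G: "G \<in> Ind UNIV E" "F \<subseteq> G" for G
  proof (rule cohen_macaulay_link_connected[OF cm, of "R \<inter> A" "R - A" a F b G])
    show "H \<in> Ind UNIV E" if "K \<in> Ind UNIV E" "H \<subseteq> K" for K H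
      using that unfolding Ind_def independent_def by blast
    show "a \<in> R \<inter> A - F" "b \<in> R - A - F" using a b unfolding R by blast+
    show "insert a F \<in> Ind UNIV E" "insert b F \<in> Ind UNIV E"
      using join[of "{a}"] join[of "{b}"] a b by auto
    show "H \<subseteq> F \<union> (R \<inter> A) \<or> H \<subseteq> F \<union> (R - A)" if H: "H \<in> Ind UNIV E" "F \<subseteq> H" for H
    proof (rule ccontr)
      have no: "\<not> E u v" if "u \<in> H" "v \<in> H" for u v
        using H(1) that unfolding Ind_def independent_def by blast
      have HR: "H \<subseteq> F \<union> R" using no H(2) unfolding R nbh_def by blast
      assume "\<not> ?thesis"
      then obtain x y where "x \<in> H" "x \<in> R \<inter> A" "y \<in> H" "y \<in> R - A" using HR by blast
      then show False using no complete by blast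
    qed
  qed (use G in auto)
  have le: "card S \<le> 1" if S: "S \<subseteq> R" "S \<subseteq> A \<or> S \<inter> A = {}" for S
  proof -
    have "card (F \<union> S) = card F + card S"
      by (rule card_Un_disjoint) (use S(1) R in auto)
    moreover have "card (F \<union> S) \<le> Suc (card F)" by (rule small[OF join[OF S]]) blast
    ultimately show ?thesis by simp
  qed
  have "card (R \<inter> A) \<le> 1" "card (R - A) \<le> 1" by (rule le; blast)+
  moreover have "card (R \<inter> A) \<noteq> 0" "card (R - A) \<noteq> 0" using a b by auto
  ultimately have "card (R \<inter> A) = 1" "card (R - A) = 1" by linarith+
  then show "card (R \<inter> A) = 1 \<and> card (R - A) = 1" ..
qed

theorem theorem4p12:
  fixes E :: "'v::finite \<Rightarrow> 'v \<Rightarrow> bool"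
  assumes "simple_graph_on UNIV E"
    and "bipartite_on UNIV E"
    and "cohen_macaulay_over TYPE('k::field) (Ind UNIV E)"
  shows "\<exists>(W :: nat set) H. simple_graph_on W H \<and>
           face_vector_is (Ind W H) (map (hvec (Ind UNIV E)) [0..<hvec_last (Ind UNIV E) + 1])"
proof -
  have sym: "E v u" if "E u v" for u v
    using assms(1) that unfolding simple_graph_on_def by blast
  obtain A where bip: "\<And>u v. E u v \<Longrightarrow> u \<in> A \<longleftrightarrow> v \<notin> A"
    using assms(2) unfolding bipartite_on_def by metis
  have "link_rigid E A UNIV"
    by (rule cohen_macaulay_bipartite_link_rigid[OF assms(3)]) (use sym bip in blast)+
  then obtain \<sigma> where order: "matching_order E (edge_ends E UNIV A) (edge_ends E UNIV (- A)) \<sigma>"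
    using link_rigid_matching_order[of E A UNIV] sym bip by auto
  interpret matched_graph E "edge_ends E UNIV A" "edge_ends E UNIV (- A)" \<sigma>
  proof
    show "edge_ends E UNIV A \<inter> edge_ends E UNIV (- A) = {}" unfolding edge_ends_def by blast
    show "u \<in> edge_ends E UNIV A \<and> v \<in> edge_ends E UNIV (- A) \<or>
        u \<in> edge_ends E UNIV (- A) \<and> v \<in> edge_ends E UNIV A" if "E u v" for u v
      using that sym[OF that] bip[OF that] unfolding edge_ends_def by blast
  qed (rule order, rule sym)
  show ?thesis by (rule hvec_is_face_vector)
qed

end
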